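(* Let $N \in \mathbb{N}$ with $N\ge 1$, let $k \in \mathbb{N}$ with $k \ge 1$, let $\ell \in \{0, \dotsc, k - 1\}$, let $1 \le p < q < \infty$, let $0<\sigma<1$ and let $\lambda\in\mathbb{R}$ satisfy $-\ell \le \lambda \le \frac{(k+\sigma) p - \ell q}{q - p}$. Then there exists a constant $C$ (depending only on $N,k,\ell,p,q,\sigma,\lambda$) such that for every $\rho > 0$ and every $u \in W^{k+\sigma, p} (\mathbb{R}^N) \cap \mathcal{L}^{1, \lambda}_{\ell, \rho} (\mathbb{R}^N)$, one has $D^\ell u \in L^q (\mathbb{R}^N)$ and \[ \int_{\mathbb{R}^N} \rho^{\ell q} |D^\ell u|^q \le C \bigl(\rho^{-\lambda} |u|_{\mathcal{L}^{1, \lambda}_{\ell, \rho} (\mathbb{R}^N)}\bigr)^{q - p} \Bigl(\rho^{p(k + \sigma)} \int_{\mathbb{R}^N} \int_{\mathbb{R}^N} \frac{|D^k u (x) - D^k u (y)|^p}{|x - y|^{N + \sigma p}} \,\mathrm{d} x \,\mathrm{d} y + \int_{\mathbb{R}^N} \rho^{\ell p} |D^\ell u|^p\Bigr). \]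
   Context: $W^{k+\sigma,p}(\mathbb{R}^N)$, for $k\in\mathbb{N}$ and $0<\sigma<1$, is the fractional Sobolev space of functions $u\in W^{k,p}(\mathbb{R}^N)$ such that $\int_{\mathbb{R}^N} \int_{\mathbb{R}^N} \frac{|D^k u (x) - D^k u (y)|^p}{|x - y|^{N + \sigma p}} \,\mathrm{d} x \,\mathrm{d} y<\infty$; here $D^j u$ denotes the (tensor-valued) weak derivative of order $j$, with $D^0u=u$. $B_r(x)$ is the ball of radius $r$ centred at $x$. $\mathcal{P}_{\ell-1}(\mathbb{R}^N)$ is the space of polynomials on $\mathbb{R}^N$ of degree at most $\ell-1$, with the convention $\mathcal{P}_{-1}(\mathbb{R}^N)=\{0\}$. For $\rho>0$ and $\lambda\in\mathbb{R}$, the localized Campanato semi-norm is \[ |u|_{\mathcal{L}^{1,\lambda}_{\ell,\rho}(\mathbb{R}^N)} = \sup_{x\in\mathbb{R}^N,\; r\in(0,\rho)} r^\lambda \inf_{P\in\mathcal{P}_{\ell-1}(\mathbb{R}^N)} \frac{1}{|B_r(x)|}\int_{B_r(x)} |u-P|, \] and $\mathcal{L}^{1,\lambda}_{\ell,\rho}(\mathbb{R}^N)$ is the set of locally integrable functions $u$ for which this quantity is finite. *)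

theory Defs
  imports "HOL-Analysis.Analysis"
begin

text \<open>
  The space \<open>\<real>\<^sup>N\<close> is \<^typ>\<open>real ^ 'n\<close> with \<open>N = CARD('n)\<close>, carrying Lebesgue measure.
  A tensor of order \<open>j\<close> is given by its components, indexed by the lists of length \<open>j\<close> of
  coordinate indices; components at lists of other lengths are irrelevant.
\<close>

definition locally_integrable :: "(real ^ 'n \<Rightarrow> real) \<Rightarrow> bool" where
  "locally_integrable f \<longleftrightarrow> (\<forall>K. compact K \<longrightarrow> set_integrable lebesgue K f)"

primrec iter_partial :: "'n list \<Rightarrow> (real ^ 'n \<Rightarrow> real) \<Rightarrow> real ^ 'n \<Rightarrow> real" where
  "iter_partial [] f = f"
| "iter_partial (i # is) f =
     (\<lambda>x. frechet_derivative (iter_partial is f) (at x) (axis i 1))"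

text \<open>
  Differentiability of all iterated partial derivatives at every point also gives their continuity.
\<close>

definition test_function :: "(real ^ 'n \<Rightarrow> real) \<Rightarrow> bool" where
  "test_function \<phi> \<longleftrightarrow>
     (\<forall>is x. iter_partial is \<phi> differentiable (at x)) \<and> compact (closure {x. \<phi> x \<noteq> 0})"

definition tensor_norm :: "nat \<Rightarrow> ('n::finite list \<Rightarrow> real) \<Rightarrow> real" where
  "tensor_norm j T = sqrt (\<Sum>is | length is = j. (T is)\<^sup>2)"

definition has_weak_deriv ::
  "nat \<Rightarrow> (real ^ 'n \<Rightarrow> real) \<Rightarrow> (real ^ 'n \<Rightarrow> 'n list \<Rightarrow> real) \<Rightarrow> bool" where
  "has_weak_deriv j u v \<longleftrightarrow>
     locally_integrable u \<and>
     (\<forall>is. length is = j \<longrightarrow>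
        locally_integrable (\<lambda>x. v x is) \<and>
        (\<forall>\<phi>. test_function \<phi> \<longrightarrow>
           (LINT x|lebesgue. u x * iter_partial is \<phi> x)
             = (-1) ^ j * (LINT x|lebesgue. v x is * \<phi> x)))"

text \<open>
  A representative of the weak derivative \<open>D\<^sup>j u\<close>, meaningful if \<open>u\<close> has one; it is then
  determined up to null sets. In particular \<open>weak_deriv 0 u\<close> is \<open>u\<close> almost everywhere.
\<close>

definition weak_deriv :: "nat \<Rightarrow> (real ^ 'n \<Rightarrow> real) \<Rightarrow> real ^ 'n \<Rightarrow> 'n list \<Rightarrow> real" where
  "weak_deriv j u = (SOME v. has_weak_deriv j u v)"

definition tensor_Lp :: "nat \<Rightarrow> real \<Rightarrow> (real ^ 'n \<Rightarrow> 'n list \<Rightarrow> real) set" where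
  "tensor_Lp j p =
     {v. (\<forall>is. length is = j \<longrightarrow> (\<lambda>x. v x is) \<in> borel_measurable lebesgue) \<and>
         integrable lebesgue (\<lambda>x. tensor_norm j (v x) powr p)}"

definition sobolev :: "nat \<Rightarrow> real \<Rightarrow> (real ^ 'n \<Rightarrow> real) set" where
  "sobolev k p = {u. \<forall>j\<le>k. (\<exists>v. has_weak_deriv j u v) \<and> weak_deriv j u \<in> tensor_Lp j p}"

definition gagliardo ::
  "nat \<Rightarrow> real \<Rightarrow> real \<Rightarrow> (real ^ 'n \<Rightarrow> real) \<Rightarrow> ennreal" where
  "gagliardo k \<sigma> p u =
     (\<integral>\<^sup>+x. (\<integral>\<^sup>+y. ennreal
        (tensor_norm k (\<lambda>is. weak_deriv k u x is - weak_deriv k u y is) powr p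
           / norm (x - y) powr (real CARD('n) + \<sigma> * p)) \<partial>lebesgue) \<partial>lebesgue)"

definition frac_sobolev :: "nat \<Rightarrow> real \<Rightarrow> real \<Rightarrow> (real ^ 'n \<Rightarrow> real) set" where
  "frac_sobolev k \<sigma> p = {u \<in> sobolev k p. gagliardo k \<sigma> p u < \<infinity>}"

text \<open>
  The polynomials of degree strictly less than \<open>l\<close>, that is, at most \<open>l - 1\<close>; for \<open>l = 0\<close> only
  the zero polynomial.
\<close>

definition polys_deg_less :: "nat \<Rightarrow> (real ^ 'n \<Rightarrow> real) set" where
  "polys_deg_less l =
     {P. \<exists>c :: ('n \<Rightarrow> nat) \<Rightarrow> real. \<forall>x.
           P x = (\<Sum>\<alpha> | (\<Sum>i\<in>UNIV. \<alpha> i) < l. c \<alpha> * (\<Prod>i\<in>UNIV. (x $ i) ^ \<alpha> i))}"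

definition campanato_seminorm ::
  "nat \<Rightarrow> real \<Rightarrow> real \<Rightarrow> (real ^ 'n \<Rightarrow> real) \<Rightarrow> ennreal" where
  "campanato_seminorm l \<rho> lam u =
     (SUP x. SUP r\<in>{0<..<\<rho>}.
        ennreal (r powr lam) *
        (INF P\<in>polys_deg_less l.
           (\<integral>\<^sup>+y\<in>ball x r. ennreal \<bar>u y - P y\<bar> \<partial>lebesgue) / emeasure lebesgue (ball x r)))"

definition campanato :: "nat \<Rightarrow> real \<Rightarrow> real \<Rightarrow> (real ^ 'n \<Rightarrow> real) set" where
  "campanato l \<rho> lam = {u. locally_integrable u \<and> campanato_seminorm l \<rho> lam u < \<infinity>}"

end

theory Submission
  imports Defs
begin

text \<open>
  Let \<open>h\<close> be a product bump of mass one and \<open>E s\<close> the mollification of a component of \<open>D\<^sup>l u\<close> at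
  scale \<open>s\<close>. Moving the \<open>l\<close> derivatives onto the kernel, which kills polynomials of degree less
  than \<open>l\<close>, gives \<open>\<bar>E s x\<bar> \<le> C s\<^sup>-\<^sup>l\<^sup>-\<^sup>\<lambda> A\<close> with the Campanato semi-norm \<open>A\<close>. The bump can be chosen
  such that \<open>E (s/2) - E s\<close> is a mollification with a kernel that is a derivative of order
  \<open>k - l\<close> of kernels of mean zero; moving these derivatives onto \<open>D\<^sup>l u\<close> and subtracting \<open>D\<^sup>k u x\<close> gives
  \<open>\<bar>E (s/2) x - E s x\<bar> \<le> C s\<^sup>k\<^sup>-\<^sup>l\<^sup>+\<^sup>\<sigma> G x\<close>, where \<open>G x powr p\<close> is the inner integral of the Gagliardo
  semi-norm. Summing over dyadic scales, \<open>\<bar>D\<^sup>l u x\<bar> \<le> C (s\<^sup>-\<^sup>l\<^sup>-\<^sup>\<lambda> A + s\<^sup>k\<^sup>-\<^sup>l\<^sup>+\<^sup>\<sigma> G x)\<close> for almost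
  every \<open>x\<close> and all \<open>s = \<rho>/2, \<rho>/4, \<dots>\<close>. Choosing the best \<open>s\<close> at each \<open>x\<close> and integrating
  proves the theorem.
\<close>

subsection \<open>Smooth bump functions on the line\<close>

text \<open>The obstacle is the order of the dyadic increments. A kernel that merely has mean zero
  sees the gradient of \<open>D^l u\<close> and in general gains no more than one order of
  \<open>s\<close>; order \<open>k - l + \<sigma>\<close> requires a kernel orthogonal to all
  polynomials of degree at most \<open>k - l\<close>, so the bump has to be built for the given
  \<open>k - l\<close>. All kernels are products over the coordinates: derivatives, integrals and
  moments reduce to one variable, and the scale can be halved one coordinate at a time.

  The scale that is best at \<open>x\<close> may exceed \<open>\<rho>\<close>, where the semi-norm
  gives no information. At such points \<open>D^l u\<close> is already bounded by a multiple of
  \<open>\<rho>^(-l-\<lambda>) A\<close>, and the integral of \<open>|D^l u|^p\<close> on the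
  right-hand side accounts for them. The lower bound on \<open>\<lambda>\<close> makes
  \<open>s^(-l-\<lambda>)\<close> nonincreasing in \<open>s\<close>. The upper bound, equivalent to
  \<open>(q - p) * (l + \<lambda>) \<le> p * (k - l + \<sigma>)\<close>, says that the scale
  dictated by the Gagliardo term is still large enough for the Campanato term.\<close>

primrec kdiff :: "nat \<Rightarrow> (real \<Rightarrow> real) \<Rightarrow> bool" where
  "kdiff 0 g = True"
| "kdiff (Suc n) g = (\<exists>g'. (\<forall>t. (g has_real_derivative g' t) (at t)) \<and> kdiff n g')"

text \<open>Differentiability is split into finite orders with an existentially chosen derivative,
  so that closure under products and affine substitutions is an induction on the order and needs no
  formula for higher derivatives.\<close>

definition smooth :: "(real \<Rightarrow> real) \<Rightarrow> bool" where
  "smooth g \<longleftrightarrow> (\<forall>n. kdiff n g)"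

lemma deriv_unique:
  fixes g :: "real \<Rightarrow> real"
  assumes "\<And>t. (g has_real_derivative g' t) (at t)"
  shows "deriv g = g'"
  using assms by (auto intro!: DERIV_imp_deriv)

lemma kdiff_SucI:
  "(\<And>t. (g has_real_derivative g' t) (at t)) \<Longrightarrow> kdiff n g' \<Longrightarrow> kdiff (Suc n) g"
  by auto

lemma kdiff_Suc_D: "kdiff (Suc n) g \<Longrightarrow> kdiff n g"
  by (induction n arbitrary: g) auto

lemma smooth_coinduct_step:
  assumes "\<And>t. (g has_real_derivative g' t) (at t)" "smooth g'"
  shows "smooth g"
  unfolding smooth_def
proof
  fix n show "kdiff n g" using assms by (cases n) (auto simp: smooth_def)
qed

lemma smooth_DERIV:
  assumes "smooth g"
  shows "(g has_real_derivative deriv g t) (at t)"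
proof -
  have "kdiff (Suc 0) g" using assms by (simp only: smooth_def)
  then obtain g' where g': "\<And>t. (g has_real_derivative g' t) (at t)" by auto
  then have "deriv g = g'" by (rule deriv_unique)
  with g' show ?thesis by simp
qed

lemma smooth_deriv:
  assumes "smooth g"
  shows "smooth (deriv g)"
  unfolding smooth_def
proof
  fix n
  have "kdiff (Suc n) g" using assms by (simp only: smooth_def)
  then obtain g' where g': "\<And>t. (g has_real_derivative g' t) (at t)" "kdiff n g'" by auto
  then show "kdiff n (deriv g)" using deriv_unique[of g g'] by simp
qed

lemma smooth_higher_deriv: "smooth g \<Longrightarrow> smooth ((deriv ^^ n) g)"
  by (induction n) (auto intro: smooth_deriv)

lemma smooth_higher_DERIV:
  "smooth g \<Longrightarrow> ((deriv ^^ n) g has_real_derivative (deriv ^^ Suc n) g t) (at t)"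
  using smooth_DERIV[OF smooth_higher_deriv] by simp

lemma smooth_isCont: "smooth g \<Longrightarrow> isCont g t"
  using smooth_DERIV DERIV_isCont by blast

lemma smooth_continuous_on: "smooth g \<Longrightarrow> continuous_on S g"
  by (simp add: smooth_isCont continuous_at_imp_continuous_on)

lemma smooth_borel_measurable: "smooth g \<Longrightarrow> g \<in> borel_measurable borel"
  by (simp add: borel_measurable_continuous_onI smooth_continuous_on)

section \<open>Closure properties of smooth functions\<close>

lemma kdiff_add: "kdiff n f \<Longrightarrow> kdiff n g \<Longrightarrow> kdiff n (\<lambda>t. f t + g t)"
proof (induction n arbitrary: f g)
  case (Suc n)
  then obtain f' g' where *: "\<And>t. (f has_real_derivative f' t) (at t)" "kdiff n f'"
    "\<And>t. (g has_real_derivative g' t) (at t)" "kdiff n g'" by auto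
  show ?case
    by (rule kdiff_SucI[OF DERIV_add[OF *(1,3)] Suc.IH[OF *(2,4)]])
qed simp

lemma kdiff_mult: "kdiff n f \<Longrightarrow> kdiff n g \<Longrightarrow> kdiff n (\<lambda>t. f t * g t)"
proof (induction n arbitrary: f g)
  case (Suc n)
  then obtain f' g' where *: "\<And>t. (f has_real_derivative f' t) (at t)" "kdiff n f'"
    "\<And>t. (g has_real_derivative g' t) (at t)" "kdiff n g'" by auto
  show ?case
  proof (rule kdiff_SucI[OF DERIV_mult[OF *(1,3)]])
    show "kdiff n (\<lambda>t. f' t * g t + g' t * f t)"
      by (rule kdiff_add[OF Suc.IH[OF *(2) kdiff_Suc_D[OF Suc.prems(2)]] Suc.IH[OF *(4) kdiff_Suc_D[OF Suc.prems(1)]]])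
  qed
qed simp

lemma kdiff_const: "kdiff n (\<lambda>t. c)"
proof (induction n arbitrary: c)
  case (Suc n)
  show ?case by (rule kdiff_SucI[where g' = "\<lambda>_. 0"]) (simp_all add: Suc.IH)
qed simp

lemma DERIV_affine_chain:
  fixes g :: "real \<Rightarrow> real"
  assumes "\<And>t. (g has_real_derivative g' t) (at t)"
  shows "((\<lambda>t. g (a * t + b)) has_real_derivative a * g' (a * t + b)) (at t)"
proof -
  have "((\<lambda>t. a * t + b) has_real_derivative a) (at t)"
    by (auto intro!: derivative_eq_intros)
  from DERIV_chain2[where f = g and g = "\<lambda>t. a * t + b", OF assms this] show ?thesis
    by (simp only: mult.commute)
qed

lemma kdiff_affine: "kdiff n g \<Longrightarrow> kdiff n (\<lambda>t. g (a * t + b))"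
proof (induction n arbitrary: g)
  case (Suc n)
  then obtain g' where *: "\<And>t. (g has_real_derivative g' t) (at t)" "kdiff n g'" by auto
  show ?case
  proof (rule kdiff_SucI[where g' = "\<lambda>t. a * g' (a * t + b)"])
    show "kdiff n (\<lambda>t. a * g' (a * t + b))"
      using * by (intro kdiff_mult kdiff_const Suc.IH)
    show "((\<lambda>t. g (a * t + b)) has_real_derivative a * g' (a * t + b)) (at t)" for t
      by (rule DERIV_affine_chain[OF *(1)])
  qed
qed simp

lemma smooth_add: "smooth f \<Longrightarrow> smooth g \<Longrightarrow> smooth (\<lambda>t. f t + g t)"
  and smooth_mult: "smooth f \<Longrightarrow> smooth g \<Longrightarrow> smooth (\<lambda>t. f t * g t)"
  and smooth_const: "smooth (\<lambda>t. c)"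
  and smooth_affine: "smooth g \<Longrightarrow> smooth (\<lambda>t. g (a * t + b))"
  by (simp_all add: smooth_def kdiff_add kdiff_mult kdiff_const kdiff_affine)

lemma higher_deriv_affine:
  assumes "smooth g"
  shows "(deriv ^^ n) (\<lambda>t. c * g (a * t + b)) = (\<lambda>t. c * a ^ n * (deriv ^^ n) g (a * t + b))"
proof (induction n)
  case (Suc n)
  have "deriv (\<lambda>t. c * a ^ n * (deriv ^^ n) g (a * t + b)) = (\<lambda>t. c * a ^ Suc n * (deriv ^^ Suc n) g (a * t + b))"
  proof (rule deriv_unique)
    fix t
    show "((\<lambda>t. c * a ^ n * (deriv ^^ n) g (a * t + b)) has_real_derivative
        c * a ^ Suc n * (deriv ^^ Suc n) g (a * t + b)) (at t)"
      using DERIV_cmult[OF DERIV_affine_chain[OF smooth_higher_DERIV[OF assms, of n], of a b t], of "c * a ^ n"]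
      by (simp add: mult_ac)
  qed
  then show ?case using Suc by simp
qed simp

lemma higher_deriv_lincomb:
  assumes "smooth f" "smooth g"
  shows "(deriv ^^ n) (\<lambda>t. a * f t + b * g t) = (\<lambda>t. a * (deriv ^^ n) f t + b * (deriv ^^ n) g t)"
proof (induction n)
  case (Suc n)
  have "deriv (\<lambda>t. a * (deriv ^^ n) f t + b * (deriv ^^ n) g t)
      = (\<lambda>t. a * (deriv ^^ Suc n) f t + b * (deriv ^^ Suc n) g t)"
    by (rule deriv_unique)
      (use smooth_higher_DERIV[OF assms(1)] smooth_higher_DERIV[OF assms(2)] in
        \<open>auto intro!: DERIV_add DERIV_cmult\<close>)
  then show ?case using Suc by simp
qed simp

text \<open>On the positive half-line, every derivative of \<open>exp (- (1 / t))\<close> is a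
  polynomial in \<open>1 / t\<close> times the same exponential. Admitting all polynomials
  \<open>P\<close> makes the family closed under differentiation.\<close>

definition flat_exp :: "real poly \<Rightarrow> real \<Rightarrow> real" where
  "flat_exp P t = (if t > 0 then poly P (1 / t) * exp (- (1 / t)) else 0)"

lemma poly_exp_tendsto_0: "((\<lambda>x::real. poly P x * exp (- x)) \<longlongrightarrow> 0) at_top"
proof -
  have "((\<lambda>x::real. \<Sum>i\<le>degree P. coeff P i * (x ^ i / exp x)) \<longlongrightarrow> (\<Sum>i\<le>degree P. coeff P i * 0)) at_top"
    by (intro tendsto_sum tendsto_mult tendsto_const tendsto_power_div_exp_0)
  moreover have "(\<lambda>x::real. \<Sum>i\<le>degree P. coeff P i * (x ^ i / exp x)) = (\<lambda>x. poly P x * exp (- x))"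
    by (simp add: poly_altdef sum_distrib_right exp_minus divide_inverse mult.assoc)
  ultimately show ?thesis by simp
qed

text \<open>With \<open>X = 1 / t\<close> one has \<open>dX/dt = - X^2\<close>, so
  \<open>P(X) exp(-X)\<close> has the derivative \<open>X^2 (P(X) - P'(X)) exp(-X)\<close>;
  \<open>[:0,0,1:]\<close> is the polynomial \<open>X^2\<close>. At 0 the right difference quotient
  is \<open>X P(X) exp(-X)\<close> with \<open>X\<close> tending to infinity, where the exponential
  wins.\<close>

lemma flat_exp_DERIV:
  "(flat_exp P has_real_derivative flat_exp ([:0,0,1:] * (P - pderiv P)) t) (at t)"
proof -
  consider "t > 0" | "t < 0" | "t = 0" by linarith
  then show ?thesis
  proof cases
    case 1
    have "((\<lambda>t. poly P (1 / t) * exp (- (1 / t))) has_real_derivative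
        flat_exp ([:0,0,1:] * (P - pderiv P)) t) (at t)"
    proof -
      have "((\<lambda>t. 1 / t) has_real_derivative - (1 / t\<^sup>2)) (at t)"
        using 1 by (auto intro!: derivative_eq_intros simp: power2_eq_square)
      from DERIV_mult[OF DERIV_chain2[OF poly_DERIV this] DERIV_chain2[OF DERIV_exp DERIV_minus[OF this]]]
      show ?thesis
        by (rule DERIV_cong) (use 1 in \<open>simp add: flat_exp_def power2_eq_square algebra_simps\<close>)
    qed
    then show ?thesis
      by (rule has_field_derivative_transform_within_open[where S = "{0<..}"])
        (use 1 in \<open>auto simp: flat_exp_def\<close>)
  next
    case 2
    have "((\<lambda>t. 0) has_real_derivative flat_exp ([:0,0,1:] * (P - pderiv P)) t) (at t)"
      using 2 by (auto simp: flat_exp_def)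
    then show ?thesis
      by (rule has_field_derivative_transform_within_open[where S = "{..<0}"])
        (use 2 in \<open>auto simp: flat_exp_def\<close>)
  next
    case 3
    have "((\<lambda>h. flat_exp P h / h) \<longlongrightarrow> 0) (at_right 0)"
    proof -
      have "((\<lambda>x. poly (pCons 0 P) x * exp (- x)) \<longlongrightarrow> 0) at_top"
        by (rule poly_exp_tendsto_0)
      then have "((\<lambda>h. poly (pCons 0 P) (inverse h) * exp (- inverse h)) \<longlongrightarrow> 0) (at_right (0::real))"
        by (rule filterlim_compose) (rule filterlim_inverse_at_top_right)
      then show ?thesis
        by (rule tendsto_cong[THEN iffD1, rotated])
          (auto simp: eventually_at_filter flat_exp_def field_simps)
    qed
    moreover have "((\<lambda>h. flat_exp P h / h) \<longlongrightarrow> 0) (at_left 0)"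
      by (rule tendsto_eventually) (auto simp: eventually_at_filter flat_exp_def)
    ultimately have "((\<lambda>h. flat_exp P h / h) \<longlongrightarrow> 0) (at 0)"
      by (simp add: filterlim_at_split)
    then show ?thesis using 3 by (simp add: has_field_derivative_iff flat_exp_def)
  qed
qed

lemma smooth_flat_exp: "smooth (flat_exp P)"
proof -
  have "kdiff n (flat_exp P)" for n
    by (induction n arbitrary: P) (auto intro!: exI flat_exp_DERIV)
  then show ?thesis by (simp add: smooth_def)
qed

section \<open>Smooth functions of compact support on the line and their moments\<close>

definition cbump :: "real \<Rightarrow> (real \<Rightarrow> real) \<Rightarrow> bool" where
  "cbump d g \<longleftrightarrow> smooth g \<and> (\<forall>t. \<bar>t\<bar> > d \<longrightarrow> g t = 0)"

lemma cbumpD: assumes "cbump d g" shows "smooth g" "\<bar>t\<bar> > d \<Longrightarrow> g t = 0"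
  using assms by (auto simp: cbump_def)

lemma cbump_deriv: assumes "cbump d g" shows "cbump d (deriv g)"
  unfolding cbump_def
proof (intro conjI allI impI)
  show "smooth (deriv g)" using assms by (simp add: cbump_def smooth_deriv)
  fix t :: real assume t: "d < \<bar>t\<bar>"
  have "((\<lambda>_. 0) has_real_derivative 0) (at t)" by simp
  then have "(g has_real_derivative 0) (at t)"
    by (rule has_field_derivative_transform_within_open[where S = "{t. d < \<bar>t\<bar>}"])
      (use t assms in \<open>auto simp: cbump_def intro!: open_Collect_less continuous_intros\<close>)
  then show "deriv g t = 0" by (rule DERIV_imp_deriv)
qed

lemma cbump_higher_deriv: "cbump d g \<Longrightarrow> cbump d ((deriv ^^ n) g)"
  by (induction n) (auto intro: cbump_deriv)

lemma cbump_lincomb: "cbump d f \<Longrightarrow> cbump d g \<Longrightarrow> cbump d (\<lambda>t. a * f t + b * g t)"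
  unfolding cbump_def by (auto intro!: smooth_add smooth_mult smooth_const)

lemma cbump_dilate: "cbump d g \<Longrightarrow> cbump d (\<lambda>t. 2 * g (2 * t))"
  unfolding cbump_def using smooth_affine[of g 2 0] by (auto intro!: smooth_mult smooth_const)

lemma cbump_bounded: assumes "cbump d g" shows "\<exists>B\<ge>0. \<forall>t. \<bar>g t\<bar> \<le> B"
proof -
  have "compact (g ` {-d..d})"
    using assms by (intro compact_continuous_image smooth_continuous_on) (auto simp: cbump_def)
  then have "\<exists>B. \<forall>t\<in>{-d..d}. \<bar>g t\<bar> \<le> B"
    by (auto simp: bounded_iff dest!: compact_imp_bounded)
  then obtain B where B: "\<And>t. t \<in> {-d..d} \<Longrightarrow> \<bar>g t\<bar> \<le> B" by blast
  have "\<bar>g t\<bar> \<le> max B 0" for t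
    using B[of t] cbumpD(2)[OF assms, of t] by (cases "\<bar>t\<bar> > d") (auto simp: le_max_iff_disj abs_le_iff not_less)
  then show ?thesis by (intro exI[of _ "max B 0"]) auto
qed

lemma cbump_integrable: assumes "cbump d g" shows "integrable lborel g"
proof -
  have "set_integrable lborel {-d..d} g"
    unfolding set_integrable_def using assms
    by (intro borel_integrable_compact smooth_continuous_on) (auto simp: cbump_def)
  moreover have "(\<lambda>t. indicator {-d..d} t *\<^sub>R g t) = g"
    using cbumpD(2)[OF assms] by (auto simp: fun_eq_iff indicator_def not_le abs_less_iff) (metis abs_le_D2 abs_le_iff minus_le_iff not_le)+
  ultimately show ?thesis by (simp add: set_integrable_def)
qed

lemma integral_deriv_compact_support:
  assumes F: "\<And>t. (F has_real_derivative f t) (at t)" "continuous_on UNIV f"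
    and supp: "\<And>t. \<bar>t\<bar> > d \<Longrightarrow> F t = 0 \<and> f t = 0"
  shows "(LINT t|lborel. f t) = 0"
proof -
  \<comment> \<open>The absolute value allows for negative \<open>d\<close>; adding 1 puts both
    endpoints strictly outside \<open>[-d, d]\<close>, where \<open>F\<close> vanishes.\<close>
  define a where "a = \<bar>d\<bar> + 1"
  have "(LINT t|lborel. indicator {-a..a} t *\<^sub>R f t) = F a - F (-a)"
    using F by (intro integral_FTC_atLeastAtMost)
      (auto simp: a_def has_real_derivative_iff_has_vector_derivative[symmetric]
        intro: has_field_derivative_at_within continuous_on_subset)
  moreover have "(\<lambda>t. indicator {-a..a} t *\<^sub>R f t) = f"
  proof
    fix t show "indicator {-a..a} t *\<^sub>R f t = f t"
      using supp[of t] by (cases "\<bar>t\<bar> > d") (auto simp: a_def indicator_def)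
  qed
  moreover have "F a = 0" "F (-a) = 0" using supp by (auto simp: a_def)
  ultimately show ?thesis by simp
qed

lemma cbump_integral_deriv: assumes "cbump d g" shows "(LINT t|lborel. deriv g t) = 0"
  using assms cbump_deriv[OF assms]
  by (intro integral_deriv_compact_support[of g _ d] smooth_DERIV smooth_continuous_on)
    (auto simp: cbump_def)

lemma cbump_moment_integrable:
  assumes "cbump d g" shows "integrable lborel (\<lambda>t. t ^ j * g t)"
proof -
  have "cbump d (\<lambda>t. t ^ j * g t)"
  proof -
    have "smooth (\<lambda>t::real. t)"
      by (rule smooth_coinduct_step[where g' = "\<lambda>_. 1"]) (auto intro: smooth_const)
    then have "smooth (\<lambda>t::real. t ^ j)"
      by (induction j) (auto intro: smooth_mult smooth_const)
    then show ?thesis using assms by (auto simp: cbump_def intro: smooth_mult)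
  qed
  then show ?thesis by (rule cbump_integrable)
qed

text \<open>Integration by parts: the derivative of \<open>t^(j+1)\<close> times a derivative of
  \<open>g\<close> of order \<open>n - 1\<close> integrates to zero, which trades one power of
  \<open>t\<close> for one derivative. In the base case a derivative of a compactly supported
  function is integrated.\<close>

lemma cbump_moment_zero:
  assumes "cbump d g" "j < n"
  shows "(LINT t|lborel. t ^ j * (deriv ^^ n) g t) = 0"
  using assms(2)
proof (induction j arbitrary: n)
  case 0
  then obtain m where "n = Suc m" by (cases n) auto
  then show ?case using cbump_integral_deriv[OF cbump_higher_deriv[OF assms(1)], of m] by simp
next
  case (Suc j)
  then obtain m where m: "n = Suc m" "j < m" by (cases n) auto
  let ?G = "(deriv ^^ m) g"
  have sm: "smooth ?G" "cbump d ?G" using assms by (auto intro: cbump_higher_deriv cbumpD)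
  have "(LINT t|lborel. (1 + real j) * (t ^ j * ?G t) + t ^ Suc j * deriv ?G t) = 0"
  proof (rule integral_deriv_compact_support[of "\<lambda>t. t ^ Suc j * ?G t" _ d])
    show "((\<lambda>t. t ^ Suc j * ?G t) has_real_derivative (1 + real j) * (t ^ j * ?G t) + t ^ Suc j * deriv ?G t) (at t)" for t
      using smooth_DERIV[OF sm(1), of t]
      by (auto intro!: derivative_eq_intros simp del: power_Suc simp: algebra_simps)
    show "continuous_on UNIV (\<lambda>t. (1 + real j) * (t ^ j * ?G t) + t ^ Suc j * deriv ?G t)"
      using sm by (intro continuous_intros smooth_continuous_on smooth_deriv)
  qed (use sm cbump_deriv[OF sm(2)] in \<open>auto simp: cbump_def\<close>)
  also have "(LINT t|lborel. (1 + real j) * (t ^ j * ?G t) + t ^ Suc j * deriv ?G t)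
     = (1 + real j) * (LINT t|lborel. t ^ j * ?G t) + (LINT t|lborel. t ^ Suc j * deriv ?G t)"
    by (subst Bochner_Integration.integral_add)
      (simp_all only: integrable_mult_right[OF cbump_moment_integrable[OF sm(2)]]
        cbump_moment_integrable[OF cbump_deriv[OF sm(2)]] integral_mult_right_zero)
  finally have "(LINT t|lborel. t ^ Suc j * deriv ?G t) = 0"
    unfolding Suc.IH[OF m(2)] by simp
  then show ?case by (simp only: m(1) funpow.simps o_apply)
qed

text \<open>\<open>g\<close> and its dilation have the same integral, so their difference has mean
  zero. The primitive \<open>H\<close> of \<open>g\<close> alone need not vanish to the right of the
  support, but it is constant there, and the constants cancel in \<open>H (2 * t) - H t\<close>.
  Since \<open>d < 1\<close>, the lower limit -1 lies to the left of the support.\<close>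

lemma cbump_dilation_primitive:
  assumes g: "cbump d g" and d: "0 < d" "d < 1"
  shows "\<exists>G. cbump d G \<and> deriv G = (\<lambda>t. 2 * g (2 * t) - g t)"
proof -
  define H where "H t = integral {-1..t} g" for t
  have cont: "continuous_on S g" for S using g by (auto simp: cbump_def intro: smooth_continuous_on)
  have intg: "g integrable_on {a..b}" for a b by (rule integrable_continuous_interval[OF cont])
  have H0: "H t = 0" if "t < -d" for t
  proof -
    have "integral {-1..t} g = integral {-1..t} (\<lambda>_. 0)"
      using g that by (intro integral_cong) (auto simp: cbump_def)
    then show ?thesis by (simp add: H_def)
  qed
  have H1: "H t = H d" if "t > d" for t
  proof -
    have "H t = integral {-1..d} g + integral {d..t} g"
      unfolding H_def using that d intg
      by (intro Henstock_Kurzweil_Integration.integral_combine[symmetric]) auto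
    also have "integral {d..t} g = integral {d..t} (\<lambda>_. 0)"
    proof (rule integral_spike[where S = "{d}"])
      show "\<And>x. x \<in> {d..t} - {d} \<Longrightarrow> 0 = g x" using g d by (auto simp: cbump_def)
    qed auto
    finally show ?thesis by (simp add: H_def)
  qed
  have HD: "(H has_real_derivative g t) (at t)" for t
  proof (cases "t < -d")
    case True
    have "((\<lambda>_. 0) has_real_derivative g t) (at t)" using g True d by (auto simp: cbump_def)
    then show ?thesis
      by (rule has_field_derivative_transform_within_open[where S = "{..< -d}"])
        (use True H0 in auto)
  next
    case False
    have "(H has_real_derivative g t) (at t within {-1..t+1})"
      unfolding H_def by (rule integral_has_real_derivative[OF cont]) (use False d in auto)
    then show ?thesis
      using at_within_interior[of t "{-1..t+1}"] False d by (simp add: interior_atLeastAtMost_real)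
  qed
  let ?G = "\<lambda>t. H (2 * t) - H t"
  have D: "(?G has_real_derivative 2 * g (2 * t) - g t) (at t)" for t
    using DERIV_diff[OF DERIV_affine_chain[OF HD, of 2 0] HD[of t]] by simp
  have dG: "deriv ?G = (\<lambda>t. 2 * g (2 * t) - g t)" using D by (rule deriv_unique)
  have "smooth (\<lambda>t. 2 * g (2 * t) - g t)"
    using cbump_lincomb[OF cbump_dilate[OF g] g, of 1 "-1"] by (simp add: cbump_def)
  then have "smooth ?G" using D by (intro smooth_coinduct_step[where g = ?G])
  moreover have "?G t = 0" if "\<bar>t\<bar> > d" for t
    using that d H0[of t] H0[of "2*t"] H1[of t] H1[of "2*t"] by (cases "t > 0") auto
  ultimately show ?thesis using dG by (intro exI[of _ ?G]) (auto simp: cbump_def)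
qed

lemma integral_dilate:
  fixes g :: "real \<Rightarrow> real" shows "(LINT t|lborel. 2 * g (2 * t)) = (LINT t|lborel. g t)"
  using lborel_integral_real_affine[of 2 g 0] by simp

lemma ex_cbump: assumes d: "0 < d" shows "\<exists>b. cbump d b \<and> (LINT t|lborel. b t) = 1"
proof -
  \<comment> \<open>On \<open>(-d, d)\<close> this is
    \<open>exp (- 1/(d+t)) * exp (- 1/(d-t))\<close>, and it vanishes elsewhere.\<close>
  define b where "b t = flat_exp 1 (1 * t + d) * flat_exp 1 ((-1) * t + d)" for t
  have sm: "smooth b" unfolding b_def by (intro smooth_mult smooth_affine smooth_flat_exp)
  have cb: "cbump d b" using sm by (auto simp: cbump_def b_def flat_exp_def)
  have nn: "b t \<ge> 0" for t by (simp add: b_def flat_exp_def)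
  have "(LINT t|lborel. b t) \<noteq> 0"
  proof
    assume "(LINT t|lborel. b t) = 0"
    then have "AE t in lborel. b t = 0"
      using integral_nonneg_eq_0_iff_AE[OF cbump_integrable[OF cb]] nn by auto
    then have "AE t in lborel. t \<notin> {-d<..<d}"
      by eventually_elim (auto simp: b_def flat_exp_def)
    then have "emeasure lborel {-d<..<d} = 0"
      by (subst (asm) AE_iff_measurable[OF _ refl])
        (auto simp: greaterThanLessThan_def greaterThan_def lessThan_def simp flip: Collect_conj_eq)
    then show False using d by simp
  qed
  then show ?thesis
    using cbump_lincomb[OF cb cb, of "1 / (LINT t|lborel. b t)" 0]
    by (intro exI[of _ "\<lambda>t. 1 / (LINT t|lborel. b t) * b t"]) auto
qed

text \<open>
  Write \<open>T f t = 2 * f (2 * t)\<close> and \<open>D\<close> for the derivative, so that \<open>T D\<^sup>j = 2\<^sup>-\<^sup>j D\<^sup>j T\<close>. If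
  \<open>(T - 1) h = D\<^sup>j g\<close>, then \<open>(T - 2\<^sup>-\<^sup>j) h\<close> has \<open>T - 1\<close> of it equal to \<open>2\<^sup>-\<^sup>j D\<^sup>j (T - 1) g\<close>, and
  \<open>(T - 1) g\<close> is itself a derivative; this gains one order.
\<close>

lemma ex_kernel:
  assumes d: "0 < d" "d < 1"
  shows "\<exists>h g. cbump d h \<and> cbump d g \<and> (LINT t|lborel. h t) = 1 \<and>
    (\<lambda>t. 2 * h (2 * t) - h t) = (deriv ^^ Suc n) g"
proof (induction n)
  case 0
  obtain b where b: "cbump d b" "(LINT t|lborel. b t) = 1" using ex_cbump[OF d(1)] by auto
  obtain G where G: "cbump d G" "deriv G = (\<lambda>t. 2 * b (2 * t) - b t)"
    using cbump_dilation_primitive[OF b(1) d] by blast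
  have "(deriv ^^ Suc 0) G = (\<lambda>t. 2 * b (2 * t) - b t)" using G(2) by simp
  then show ?case using b G(1) by metis
next
  case (Suc n)
  then obtain h g where h: "cbump d h" "cbump d g" "(LINT t|lborel. h t) = 1"
    and hg: "(\<lambda>t. 2 * h (2 * t) - h t) = (deriv ^^ Suc n) g" by (elim exE conjE)
  obtain G where G: "cbump d G" "deriv G = (\<lambda>t. 2 * g (2 * t) - g t)"
    using cbump_dilation_primitive[OF h(2) d] by blast
  \<comment> \<open>\<open>e\<close> is the factor \<open>2^(-j)\<close> for
    \<open>j = n + 1\<close>. Dilation preserves the integral, so the dilate of \<open>h\<close>
    minus \<open>e\<close> times \<open>h\<close> has mass \<open>1 - e\<close>; \<open>c\<close>
    restores mass one.\<close>
  define e where "e = (1/2::real) ^ Suc n"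
  define c where "c = 1 / (1 - e)"
  have e: "0 < e" "e < 1" unfolding e_def by (simp, intro power_Suc_less_one, auto)
  have sg: "smooth g" "smooth (\<lambda>t. 2 * g (2 * t + 0))" and sG: "smooth G"
    using h(2) cbump_dilate[OF h(2)] G(1) by (simp_all add: cbump_def)
  let ?h = "\<lambda>t. c * (2 * h (2 * t)) + (- c * e) * h t"
  have ch: "cbump d ?h" using h by (intro cbump_lincomb cbump_dilate)
  have "(LINT t|lborel. ?h t) = c * (LINT t|lborel. 2 * h (2 * t)) + (- c * e) * (LINT t|lborel. h t)"
    using cbump_integrable[OF cbump_dilate[OF h(1)]] cbump_integrable[OF h(1)]
    by (subst Bochner_Integration.integral_add) auto
  also have "\<dots> = 1" unfolding integral_dilate h(3) using e by (simp add: c_def divide_simps)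
  finally have i1: "(LINT t|lborel. ?h t) = 1" .
  \<comment> \<open>The zero summand brings the multiple of \<open>G\<close> into the form of a
    linear combination.\<close>
  have cg: "cbump d (\<lambda>t. c * e * G t + 0 * G t)" using G by (intro cbump_lincomb)
  have "(deriv ^^ Suc (Suc n)) (\<lambda>t. c * e * G t + 0 * G t) = (deriv ^^ Suc n) (deriv (\<lambda>t. c * e * G t + 0 * G t))"
    by (simp add: funpow_swap1)
  also have "deriv (\<lambda>t. c * e * G t + 0 * G t) = (\<lambda>t. c * e * (2 * g (2 * t + 0)) + (- c * e) * g t)"
    unfolding higher_deriv_lincomb[OF sG sG, of "Suc 0" "c * e" 0, unfolded funpow.simps comp_def id_def] G(2)
    by (simp add: right_diff_distrib)
  also have "(deriv ^^ Suc n) \<dots> = (\<lambda>t. c * e * (deriv ^^ Suc n) (\<lambda>t. 2 * g (2 * t + 0)) t + (- c * e) * (deriv ^^ Suc n) g t)"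
    by (rule higher_deriv_lincomb[OF sg(2,1)])
  also have "\<dots> = (\<lambda>t. c * (2 * (deriv ^^ Suc n) g (2 * t)) + (- c * e) * (deriv ^^ Suc n) g t)"
  proof
    fix t
    \<comment> \<open>The choice of \<open>e\<close> cancels the factor \<open>2^(n+1)\<close> that
      the dilation produces in the derivative of order \<open>n + 1\<close>.\<close>
    have "e * 2 ^ Suc n = 1" unfolding e_def power_mult_distrib[symmetric] by simp
    then have "c * e * (2 * 2 ^ Suc n * X) = c * (2 * X)" for X
    proof -
      have "c * e * (2 * 2 ^ Suc n * X) = c * (2 * X) * (e * 2 ^ Suc n)" by (simp only: mult_ac)
      then show ?thesis by (simp only: \<open>e * 2 ^ Suc n = 1\<close> mult_1_right)
    qed
    then show "c * e * (deriv ^^ Suc n) (\<lambda>t. 2 * g (2 * t + 0)) t + (- c * e) * (deriv ^^ Suc n) g t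
      = c * (2 * (deriv ^^ Suc n) g (2 * t)) + (- c * e) * (deriv ^^ Suc n) g t"
      unfolding higher_deriv_affine[OF sg(1)] by (simp only: add_0_right)
  qed
  also have "\<dots> = (\<lambda>t. 2 * ?h (2 * t) - ?h t)"
    unfolding hg[symmetric] by (auto simp: algebra_simps)
  finally have "(\<lambda>t. 2 * ?h (2 * t) - ?h t) = (deriv ^^ Suc (Suc n)) (\<lambda>t. c * e * G t + 0 * G t)"
    by (rule sym)
  then show ?case using ch cg i1 by (intro exI conjI)
qed

subsection \<open>Product kernels\<close>

definition tprod :: "('n \<Rightarrow> real \<Rightarrow> real) \<Rightarrow> real ^ 'n \<Rightarrow> real" where
  "tprod g y = (\<Prod>i\<in>UNIV. g i (y $ i))"

lemma tprod_fun_upd: "tprod (g(k := f)) y = f (y $ k) * (\<Prod>i\<in>UNIV - {k}. g i (y $ i))"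
proof -
  have "tprod (g(k := f)) y = (\<Prod>i\<in>insert k (UNIV - {k}). (g(k := f)) i (y $ i))"
    by (simp add: tprod_def insert_UNIV)
  also have "\<dots> = f (y $ k) * (\<Prod>i\<in>UNIV - {k}. (g(k := f)) i (y $ i))"
    by (subst prod.insert) auto
  also have "(\<Prod>i\<in>UNIV - {k}. (g(k := f)) i (y $ i)) = (\<Prod>i\<in>UNIV - {k}. g i (y $ i))"
    by (intro prod.cong) auto
  finally show ?thesis .
qed

lemma tprod_has_derivative:
  assumes "\<And>i. smooth (g i)"
  shows "(tprod g has_derivative (\<lambda>h. \<Sum>i\<in>UNIV. h $ i * tprod (g(i := deriv (g i))) y)) (at y)"
proof -
  have "((\<lambda>y. g i (y $ i)) has_derivative (\<lambda>h. h $ i * deriv (g i) (y $ i))) (at y)" for i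
  proof -
    have "((\<lambda>y. y $ i) has_derivative (\<lambda>h. h $ i)) (at y)"
      by (rule bounded_linear_imp_has_derivative[OF bounded_linear_vec_nth])
    then show ?thesis
      using smooth_DERIV[OF assms] by (rule DERIV_compose_FDERIV[rotated])
  qed
  then have "((\<lambda>y. \<Prod>i\<in>UNIV. g i (y $ i)) has_derivative
      (\<lambda>h. \<Sum>i\<in>UNIV. h $ i * deriv (g i) (y $ i) * (\<Prod>j\<in>UNIV - {i}. g j (y $ j)))) (at y)"
    by (intro has_derivative_prod) auto
  then show ?thesis
    unfolding tprod_fun_upd by (simp only: mult.assoc tprod_def[abs_def])
qed

lemma tprod_partial:
  assumes "\<And>i. smooth (g i)"
  shows "frechet_derivative (tprod g) (at y) (axis k 1) = tprod (g(k := deriv (g k))) y"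
proof -
  have "frechet_derivative (tprod g) (at y) = (\<lambda>h. \<Sum>i\<in>UNIV. h $ i * tprod (g(i := deriv (g i))) y)"
    by (rule frechet_derivative_at[OF tprod_has_derivative, symmetric]) (rule assms)
  then show ?thesis
    by (simp add: axis_def if_distrib[of "\<lambda>c. c * _"] sum.delta cong: if_cong)
qed

text \<open>Each partial derivative acts on a single factor, so the only thing that matters is how
  often an index occurs in the list, and not where.\<close>

lemma iter_partial_tprod:
  assumes "\<And>i. smooth (g i)"
  shows "iter_partial is (tprod g) = tprod (\<lambda>i. (deriv ^^ count_list is i) (g i))"
proof (induction "is")
  case (Cons k "is")
  let ?G = "\<lambda>i. (deriv ^^ count_list is i) (g i)"
  have eq: "?G(k := deriv (?G k)) = (\<lambda>i. (deriv ^^ count_list (k # is) i) (g i))"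
    by (auto simp: fun_eq_iff)
  show ?case
    unfolding iter_partial.simps Cons eq[symmetric]
    by (rule ext, rule tprod_partial, rule smooth_higher_deriv[OF assms])
qed simp

lemma iter_partial_append: "iter_partial (is @ js) f = iter_partial is (iter_partial js f)"
  by (induction "is") auto

lemma test_function_tprod:
  assumes "\<And>i. cbump (D i) (g i)"
  shows "test_function (tprod g)"
  unfolding test_function_def
proof (intro conjI allI)
  have sm: "smooth (g i)" for i using assms by (simp add: cbump_def)
  show "iter_partial is (tprod g) differentiable (at x)" for "is" x
    unfolding iter_partial_tprod[OF sm]
    by (rule differentiableI[OF tprod_has_derivative]) (rule smooth_higher_deriv[OF sm])
  have "{x. tprod g x \<noteq> 0} \<subseteq> cbox (\<chi> i. - D i) (\<chi> i. D i)"
  proof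
    fix x assume "x \<in> {x. tprod g x \<noteq> 0}"
    then have "g i (x $ i) \<noteq> 0" for i by (auto simp: tprod_def)
    then have "\<not> \<bar>x $ i\<bar> > D i" for i using assms by (auto simp: cbump_def)
    then show "x \<in> cbox (\<chi> i. - D i) (\<chi> i. D i)"
      by (auto simp: mem_box_cart not_less abs_le_iff minus_le_iff)
  qed
  then have "bounded {x. tprod g x \<noteq> 0}" using bounded_cbox bounded_subset by blast
  then show "compact (closure {x. tprod g x \<noteq> 0})" by simp
qed

text \<open>Fubini's theorem for a product of functions of one coordinate each. Lebesgue measure is
  available as the image of a product measure indexed by \<open>Basis\<close>; \<open>idx\<close>
  turns a basis vector back into its coordinate.\<close>

lemma
  fixes f :: "'n::finite \<Rightarrow> real \<Rightarrow> real"
  assumes int: "\<And>i. integrable lborel (f i)"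
  shows integrable_tprod: "integrable lborel (tprod f)"
    and integral_tprod: "(LINT y|lborel. tprod f y) = (\<Prod>i\<in>UNIV. LINT t|lborel. f i t)"
proof -
  define idx :: "real ^ 'n \<Rightarrow> 'n" where "idx = the_inv (\<lambda>i. axis i 1)"
  have inj: "inj (\<lambda>i::'n. axis i (1::real))" by (auto simp: inj_def axis_eq_axis)
  have idx: "idx (axis i 1) = i" for i unfolding idx_def by (rule the_inv_f_f[OF inj])
  have B: "(Basis :: (real ^ 'n) set) = range (\<lambda>i. axis i 1)" by (auto simp: Basis_vec_def)
  have tp: "tprod f y = (\<Prod>b\<in>Basis. f (idx b) (y \<bullet> b))" for y
    unfolding B tprod_def by (subst prod.reindex[OF inj]) (simp add: idx inner_axis)
  interpret P: product_sigma_finite "\<lambda>_::real ^ 'n. lborel :: real measure"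
    by standard
  have meas[measurable]: "f i \<in> borel_measurable borel" for i using int[of i] by simp
  have M: "tprod f \<in> borel_measurable borel" unfolding tprod_def by measurable
  have T: "(\<lambda>f. \<Sum>b\<in>Basis. f b *\<^sub>R b) \<in> measurable (\<Pi>\<^sub>M b\<in>(Basis :: (real ^ 'n) set). lborel) borel"
    by measurable
  have comp: "tprod f (\<Sum>b\<in>Basis. x b *\<^sub>R b) = (\<Prod>b\<in>Basis. f (idx b) (x b))" for x
    unfolding tp by (intro prod.cong) auto
  have "integrable (\<Pi>\<^sub>M b\<in>(Basis :: (real ^ 'n) set). lborel) (\<lambda>x. \<Prod>b\<in>Basis. f (idx b) (x b))"
    by (intro P.product_integrable_prod int) auto
  then show "integrable lborel (tprod f)"
    by (subst lborel_eq, subst integrable_distr_eq[OF T M]) (simp add: comp)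
  have "(LINT y|lborel. tprod f y) = (LINT x|(\<Pi>\<^sub>M b\<in>(Basis :: (real ^ 'n) set). lborel). (\<Prod>b\<in>Basis. f (idx b) (x b)))"
    by (subst lborel_eq, subst integral_distr[OF T M]) (simp add: comp)
  also have "\<dots> = (\<Prod>b\<in>(Basis :: (real ^ 'n) set). LINT t|lborel. f (idx b) t)"
    by (intro P.product_integral_prod int) auto
  also have "\<dots> = (\<Prod>i\<in>UNIV. LINT t|lborel. f i t)"
    unfolding B by (subst prod.reindex[OF inj]) (simp add: idx)
  finally show "(LINT y|lborel. tprod f y) = (\<Prod>i\<in>UNIV. LINT t|lborel. f i t)" .
qed

lemma sum_count_list_UNIV: "(\<Sum>i\<in>UNIV. count_list is i) = length (is :: 'n::finite list)"
proof (induction "is")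
  case (Cons k "is")
  have "count_list (k # is) i = count_list is i + (if i = k then 1 else 0)" for i by simp
  then have "(\<Sum>i\<in>UNIV. count_list (k # is) i) = (\<Sum>i\<in>UNIV. count_list is i) + (\<Sum>i\<in>UNIV. if i = k then 1 else 0)"
    by (simp only: sum.distrib)
  then show ?case by (simp add: Cons)
qed simp

text \<open>In each monomial, some coordinate is differentiated more often than its exponent.\<close>

lemma polys_deg_less_orthogonal:
  assumes g: "\<And>i. cbump (D i) (g i)" and P: "P \<in> polys_deg_less (length is)"
  shows "integrable lborel (\<lambda>y. P y * iter_partial is (tprod g) y)"
    and "(LINT y|lborel. P y * iter_partial is (tprod g) y) = 0"
proof -
  have sm: "smooth (g i)" for i using g by (simp add: cbump_def)
  obtain c where c: "P = (\<lambda>x. \<Sum>\<alpha> | (\<Sum>i\<in>UNIV. \<alpha> i) < length is. c \<alpha> * (\<Prod>i\<in>UNIV. (x $ i) ^ \<alpha> i))"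
    using P by (auto simp: polys_deg_less_def)
  define h where "h \<alpha> i t = t ^ \<alpha> i * (deriv ^^ count_list is i) (g i) t" for \<alpha> i t
  have hint: "integrable lborel (h \<alpha> i)" for \<alpha> i
    unfolding h_def by (rule cbump_moment_integrable[OF cbump_higher_deriv[OF g]])
  have eq: "P y * iter_partial is (tprod g) y
      = (\<Sum>\<alpha> | (\<Sum>i\<in>UNIV. \<alpha> i) < length is. c \<alpha> * tprod (h \<alpha>) y)" for y
    unfolding c iter_partial_tprod[OF sm] sum_distrib_right
    by (intro sum.cong) (auto simp: tprod_def h_def prod.distrib)
  have zero: "(LINT y|lborel. tprod (h \<alpha>) y) = 0" if "(\<Sum>i\<in>UNIV. \<alpha> i) < length is" for \<alpha>
  proof -
    have "\<exists>i. \<alpha> i < count_list is i"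
    proof (rule ccontr)
      assume "\<not> ?thesis"
      then have "(\<Sum>i\<in>UNIV. count_list is i) \<le> (\<Sum>i\<in>UNIV. \<alpha> i)" by (intro sum_mono) (auto simp: not_less)
      then show False using that by (simp add: sum_count_list_UNIV)
    qed
    then obtain i where "\<alpha> i < count_list is i" by auto
    then have "(LINT t|lborel. h \<alpha> i t) = 0"
      unfolding h_def by (rule cbump_moment_zero[OF g])
    then show ?thesis by (subst integral_tprod[OF hint]) (auto intro!: prod_zero)
  qed
  show "integrable lborel (\<lambda>y. P y * iter_partial is (tprod g) y)"
    unfolding eq by (intro Bochner_Integration.integrable_sum integrable_mult_right integrable_tprod hint)
  show "(LINT y|lborel. P y * iter_partial is (tprod g) y) = 0"
    unfolding eq
    by (subst Bochner_Integration.integral_sum) (auto intro!: integrable_mult_right integrable_tprod hint simp: zero)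
qed

text \<open>The mollifier at scale \<open>s\<close> centred at \<open>x\<close>. Its argument is
  \<open>y - x\<close> rather than \<open>x - y\<close>, so that derivatives in the integration
  variable \<open>y\<close> produce no signs; each coordinate carries its own \<open>1 / s\<close>,
  so that the rescaled kernel is again a product.\<close>

definition kern :: "real \<Rightarrow> real ^ 'n \<Rightarrow> ('n \<Rightarrow> real \<Rightarrow> real) \<Rightarrow> real ^ 'n \<Rightarrow> real" where
  "kern s x g y = (\<Prod>i\<in>UNIV. g i ((y $ i - x $ i) / s) / s)"

lemma kern_eq_tprod: "kern s x g = tprod (\<lambda>i t. 1 / s * g i (1 / s * t + (- x $ i / s)))"
  by (auto simp: kern_def tprod_def fun_eq_iff diff_divide_distrib)

text \<open>The radius is measured from the origin, not from \<open>c\<close>: it certifies compact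
  support, while the sharp localization around \<open>x\<close> is
  \<open>kern_support\<close>.\<close>

lemma cbump_affine:
  assumes "cbump d g" "0 < s"
  shows "cbump (\<bar>c\<bar> + d * s) (\<lambda>t. 1 / s * g (1 / s * t + (- c / s)))"
  unfolding cbump_def
proof (intro conjI allI impI)
  show "smooth (\<lambda>t. 1 / s * g (1 / s * t + (- c / s)))"
    using assms by (intro smooth_mult smooth_const smooth_affine) (simp add: cbump_def)
  fix t assume t: "\<bar>c\<bar> + d * s < \<bar>t\<bar>"
  have "d * s < \<bar>t - c\<bar>" using t by linarith
  then have "d < \<bar>t - c\<bar> / s" using assms(2) by (simp add: pos_less_divide_eq)
  then have "d < \<bar>1 / s * t + (- c / s)\<bar>" using assms(2) by (simp add: diff_divide_distrib[symmetric])
  then show "1 / s * g (1 / s * t + (- c / s)) = 0" using cbumpD(2)[OF assms(1)] by simp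
qed

lemma test_function_kern:
  assumes "\<And>i. cbump d (g i)" "0 < s"
  shows "test_function (kern s x g)"
  unfolding kern_eq_tprod by (rule test_function_tprod, rule cbump_affine[OF assms])

lemma iter_partial_kern:
  assumes "\<And>i. smooth (g i)"
  shows "iter_partial is (kern s x g) y = (1 / s) ^ length is * kern s x (\<lambda>i. (deriv ^^ count_list is i) (g i)) y"
proof -
  have sm: "smooth (\<lambda>t. 1 / s * g i (1 / s * t + (- x $ i / s)))" for i
    by (intro smooth_mult smooth_const smooth_affine assms)
  have "iter_partial is (kern s x g) y =
    (\<Prod>i\<in>UNIV. (1 / s) ^ count_list is i * ((deriv ^^ count_list is i) (g i) ((y $ i - x $ i) / s) / s))"
    unfolding kern_eq_tprod iter_partial_tprod[OF sm] higher_deriv_affine[OF assms]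
    by (simp add: tprod_def diff_divide_distrib mult_ac)
  also have "\<dots> = (1 / s) ^ length is * kern s x (\<lambda>i. (deriv ^^ count_list is i) (g i)) y"
    unfolding prod.distrib power_sum[symmetric] sum_count_list_UNIV kern_def ..
  finally show ?thesis .
qed

lemma polys_deg_less_orthogonal_kern:
  assumes "\<And>i. cbump d (g i)" "0 < s" "P \<in> polys_deg_less (length is)"
  shows "integrable lborel (\<lambda>y. P y * iter_partial is (kern s x g) y)"
    and "(LINT y|lborel. P y * iter_partial is (kern s x g) y) = 0"
  unfolding kern_eq_tprod
  using polys_deg_less_orthogonal[OF cbump_affine[OF assms(1,2)] assms(3)] by auto

lemma
  assumes "\<And>i. cbump d (g i)" "0 < s"
  shows kern_integrable: "integrable lborel (kern s x g)"
    and kern_integral: "(LINT y|lborel. kern s x g y) = (\<Prod>i\<in>UNIV. LINT t|lborel. g i t)"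
proof -
  have int: "integrable lborel (\<lambda>t. 1 / s * g i (1 / s * t + (- x $ i / s)))" for i
    by (rule cbump_integrable[OF cbump_affine[OF assms]])
  show "integrable lborel (kern s x g)" unfolding kern_eq_tprod by (rule integrable_tprod[OF int])
  have "(LINT t|lborel. 1 / s * g i (1 / s * t + (- x $ i / s))) = (LINT t|lborel. g i t)" for i
    using lborel_integral_real_affine[of "1 / s" "g i" "- x $ i / s"] assms(2)
    by (simp add: add.commute)
  then show "(LINT y|lborel. kern s x g y) = (\<Prod>i\<in>UNIV. LINT t|lborel. g i t)"
    unfolding kern_eq_tprod by (subst integral_tprod[OF int]) simp
qed

text \<open>The support lies in a cube with half-side \<open>d * s\<close>. The Euclidean norm is at
  most the sum of the moduli of the coordinates, hence at most \<open>N * d * s < s\<close>.\<close>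

lemma kern_support:
  fixes x y :: "real ^ 'n"
  assumes g: "\<And>i. cbump d (g i)" and s: "0 < s" and d: "d * real CARD('n) < 1"
    and nz: "kern s x g y \<noteq> 0"
  shows "y \<in> ball x s"
proof -
  have "g i ((y $ i - x $ i) / s) \<noteq> 0" for i using nz by (auto simp: kern_def)
  then have "\<bar>(y $ i - x $ i) / s\<bar> \<le> d" for i using cbumpD(2)[OF g] not_less by blast
  then have *: "\<bar>(y - x) $ i\<bar> \<le> d * s" for i using s by (simp add: abs_divide pos_divide_le_eq)
  have "norm (y - x) \<le> (\<Sum>i\<in>UNIV. \<bar>(y - x) $ i\<bar>)" by (rule norm_le_l1_cart)
  also have "\<dots> \<le> (\<Sum>i\<in>(UNIV :: 'n set). d * s)" by (intro sum_mono *)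
  also have "\<dots> = d * real CARD('n) * s" by simp
  also have "\<dots> < s" using d s by simp
  finally show ?thesis by (simp add: dist_norm norm_minus_commute)
qed

lemma kern_bound:
  fixes x y :: "real ^ 'n"
  assumes "\<And>i t. \<bar>g i t\<bar> \<le> B" "0 < s"
  shows "\<bar>kern s x g y\<bar> \<le> (B / s) ^ CARD('n)"
proof -
  have "\<bar>kern s x g y\<bar> = (\<Prod>i\<in>UNIV. \<bar>g i ((y $ i - x $ i) / s) / s\<bar>)" by (simp add: kern_def abs_prod)
  also have "\<dots> \<le> (\<Prod>i\<in>(UNIV :: 'n set). B / s)"
    using assms by (intro prod_mono) (auto simp: abs_divide divide_right_mono)
  finally show ?thesis by simp
qed

lemma kern_borel:
  assumes "\<And>i. smooth (g i)"
  shows "kern s x g \<in> borel_measurable borel"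
proof -
  have [measurable]: "g i \<in> borel_measurable borel" for i by (rule smooth_borel_measurable[OF assms])
  show ?thesis unfolding kern_def by measurable
qed

lemma kern_shift: "kern s x g y = kern s 0 g (y - x)"
  by (simp add: kern_def)

text \<open>Halving the scale amounts to dilating every factor, keeping its mass. The kernel is
  linear in each factor, so this change can be made one coordinate at a time.\<close>

lemma kern_dilate: "kern (s / 2) x (\<lambda>i. h i) y = kern s x (\<lambda>i t. 2 * h i (2 * t)) y"
  by (simp add: kern_def mult.commute)

lemma kern_diff_slot:
  "kern s x (g(k := f1)) y - kern s x (g(k := f2)) y = kern s x (g(k := (\<lambda>t. f1 t - f2 t))) y"
proof -
  have "kern s x (g(k := f)) y = f ((y $ k - x $ k) / s) / s * (\<Prod>i\<in>UNIV - {k}. g i ((y $ i - x $ i) / s) / s)" for f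
  proof -
    have "kern s x (g(k := f)) y = (\<Prod>i\<in>insert k (UNIV - {k}). (g(k := f)) i ((y $ i - x $ i) / s) / s)"
      by (simp add: kern_def insert_UNIV)
    also have "\<dots> = f ((y $ k - x $ k) / s) / s * (\<Prod>i\<in>UNIV - {k}. (g(k := f)) i ((y $ i - x $ i) / s) / s)"
      by (subst prod.insert) auto
    also have "(\<Prod>i\<in>UNIV - {k}. (g(k := f)) i ((y $ i - x $ i) / s) / s) = (\<Prod>i\<in>UNIV - {k}. g i ((y $ i - x $ i) / s) / s)"
      by (intro prod.cong) auto
    finally show ?thesis .
  qed
  then show ?thesis by (simp add: algebra_simps diff_divide_distrib)
qed

subsection \<open>Mollification in the mean\<close>

lemma nn_integral_lborel_shift:
  fixes f :: "'a::euclidean_space \<Rightarrow> ennreal"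
  assumes "f \<in> borel_measurable borel"
  shows "(\<integral>\<^sup>+x. f (z + x) \<partial>lborel) = (\<integral>\<^sup>+x. f x \<partial>lborel)"
proof -
  have "(\<integral>\<^sup>+x. f x \<partial>lborel) = (\<integral>\<^sup>+x. f x \<partial>distr lborel borel ((+) z))"
    by (simp only: lborel_distr_plus)
  also have "\<dots> = (\<integral>\<^sup>+x. f (z + x) \<partial>lborel)"
    using assms by (subst nn_integral_distr) auto
  finally show ?thesis by simp
qed

lemma emeasure_tail_small:
  fixes A :: "'a::euclidean_space set"
  assumes A: "A \<in> sets borel" "emeasure lborel A < \<infinity>" and e: "0 < (e::real)"
  shows "\<exists>n::nat. emeasure lborel (A - cball 0 (real n)) < ennreal e"
proof -
  have "(\<lambda>n. emeasure lborel (A - cball 0 (real n))) \<longlonglongrightarrow> emeasure lborel (\<Inter>n. A - cball 0 (real n))"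
  proof (rule Lim_emeasure_decseq)
    show "decseq (\<lambda>n. A - cball 0 (real n))"
      by (auto simp: decseq_def)
    show "emeasure lborel (A - cball 0 (real n)) \<noteq> \<infinity>" for n
    proof -
      have "emeasure lborel (A - cball 0 (real n)) \<le> emeasure lborel A"
        using A by (intro emeasure_mono) auto
      then show ?thesis using A(2) by auto
    qed
  qed (use A in auto)
  moreover have "(\<Inter>n. A - cball 0 (real n)) = {}"
  proof -
    have "\<exists>n. x \<in> cball 0 (real n)" for x :: 'a
      using real_arch_simple[of "norm x"] by auto
    then show ?thesis by blast
  qed
  ultimately have "(\<lambda>n. emeasure lborel (A - cball 0 (real n))) \<longlonglongrightarrow> 0"
    by (simp only: emeasure_empty)
  then have "eventually (\<lambda>n. emeasure lborel (A - cball 0 (real n)) < ennreal e) sequentially"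
    by (rule order_tendstoD) (use e in simp)
  then show ?thesis by (auto simp: eventually_sequentially)
qed

text \<open>Inner regularity provides a closed set; cutting it with a large ball costs little
  because \<open>A\<close> has finite measure.\<close>

lemma inner_compact_lborel:
  fixes A :: "'a::euclidean_space set"
  assumes A: "A \<in> sets borel" "emeasure lborel A < \<infinity>" and e: "0 < (e::real)"
  shows "\<exists>K. compact K \<and> K \<subseteq> A \<and> emeasure lborel (A - K) \<le> ennreal e"
proof -
  obtain n :: nat where n: "emeasure lborel (A - cball 0 (real n)) < ennreal (e / 2)"
    using emeasure_tail_small[OF A, of "e / 2"] e by auto
  obtain F where F: "closed F" "F \<subseteq> A" "emeasure lebesgue (A - F) < ennreal (e / 2)"
  proof (rule sets_lebesgue_inner_closed[of A "e / 2"])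
    show "A \<in> sets lebesgue" using A(1) by (rule sets_completionI_sets[of _ lborel, simplified])
    show "0 < e / 2" using e by simp
  qed
  have AF: "A - F \<in> sets borel" using A F by auto
  have "emeasure lborel (A - F) < ennreal (e / 2)" using F(3) AF by simp
  moreover have "emeasure lborel (A - (F \<inter> cball 0 (real n)))
     \<le> emeasure lborel ((A - F) \<union> (A - cball 0 (real n)))"
    using A F by (intro emeasure_mono) auto
  moreover have "\<dots> \<le> emeasure lborel (A - F) + emeasure lborel (A - cball 0 (real n))"
    using A F by (intro emeasure_subadditive) auto
  moreover have "emeasure lborel (A - F) + emeasure lborel (A - cball 0 (real n)) \<le> ennreal (e / 2) + ennreal (e / 2)"
    using n calculation(1) by (intro add_mono) auto
  moreover have "ennreal (e / 2) + ennreal (e / 2) = ennreal e"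
    using e by (simp flip: ennreal_plus)
  ultimately have "emeasure lborel (A - (F \<inter> cball 0 (real n))) \<le> ennreal e" by simp
  moreover have "compact (F \<inter> cball 0 (real n))" using F(1) by (simp add: closed_Int_compact)
  ultimately show ?thesis using F(2) by blast
qed

definition transl_diff :: "('a::euclidean_space \<Rightarrow> real) \<Rightarrow> 'a \<Rightarrow> ennreal" where
  "transl_diff w z = (\<integral>\<^sup>+x. ennreal \<bar>w (z + x) - w x\<bar> \<partial>lborel)"

lemma transl_diff_triangle:
  assumes [measurable]: "f \<in> borel_measurable borel" "g \<in> borel_measurable borel"
  shows "transl_diff f z \<le> transl_diff g z + 2 * (\<integral>\<^sup>+x. ennreal \<bar>f x - g x\<bar> \<partial>lborel)"
proof -
  have "transl_diff f z \<le> (\<integral>\<^sup>+x. ennreal \<bar>g (z + x) - g x\<bar> + (ennreal \<bar>f (z + x) - g (z + x)\<bar> + ennreal \<bar>f x - g x\<bar>) \<partial>lborel)"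
    unfolding transl_diff_def by (intro nn_integral_mono) (simp flip: ennreal_plus)
  also have "\<dots> = transl_diff g z + ((\<integral>\<^sup>+x. ennreal \<bar>f (z + x) - g (z + x)\<bar> \<partial>lborel) + (\<integral>\<^sup>+x. ennreal \<bar>f x - g x\<bar> \<partial>lborel))"
    unfolding transl_diff_def by (subst nn_integral_add, simp, simp)+ simp
  also have "(\<integral>\<^sup>+x. ennreal \<bar>f (z + x) - g (z + x)\<bar> \<partial>lborel) = (\<integral>\<^sup>+x. ennreal \<bar>f x - g x\<bar> \<partial>lborel)"
    by (rule nn_integral_lborel_shift[of "\<lambda>x. ennreal \<bar>f x - g x\<bar>"]) simp
  finally show ?thesis by (simp add: mult_2)
qed

text \<open>Take \<open>K\<close> compact inside \<open>A\<close> and \<open>U\<close> open around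
  it, and let the shift be shorter than the distance from \<open>K\<close> to the complement of
  \<open>U\<close>. If exactly one of \<open>x\<close> and \<open>z + x\<close> lies in
  \<open>A\<close>, then the one inside is outside \<open>K\<close>, or else the other one is in
  \<open>U - A\<close>. Both sets are small.\<close>

lemma transl_diff_indicator:
  fixes A :: "'a::euclidean_space set"
  assumes A: "A \<in> sets borel" "emeasure lborel A < \<infinity>" and e: "0 < (e::real)"
  shows "\<exists>d>0. \<forall>z. norm z < d \<longrightarrow> transl_diff (\<lambda>x. indicator A x *\<^sub>R c) z \<le> ennreal e"
proof -
  \<comment> \<open>Four small measures will occur, those of \<open>A - K\<close> and
    \<open>U - A\<close> for each of \<open>x\<close> and \<open>z + x\<close>; the added 1 allows
    \<open>c = 0\<close>.\<close>
  define e' where "e' = e / (4 * (\<bar>c\<bar> + 1))"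
  have e': "e' > 0" using e by (simp add: e'_def)
  obtain K where K: "compact K" "K \<subseteq> A" "emeasure lborel (A - K) \<le> ennreal e'"
    using inner_compact_lborel[OF A e'] by auto
  obtain U where U: "open U" "A \<subseteq> U" "emeasure lborel (U - A) < ennreal e'"
    using outer_regular_lborel[OF A(1) e'] by auto
  have "\<exists>d>0. \<forall>x\<in>K. \<forall>y\<in>- U. d \<le> dist x y"
    using K U by (intro separate_compact_closed) auto
  then obtain d where d0: "d > 0" "\<forall>x\<in>K. \<forall>y\<in>- U. d \<le> dist x y" by blast
  have d: "d > 0" "\<And>x y. x \<in> K \<Longrightarrow> dist x y < d \<Longrightarrow> y \<in> U"
    using d0 leD by blast+
  let ?h = "\<lambda>x. indicator (A - K) x + indicator (U - A) x :: ennreal"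
  have Kb: "K \<in> sets borel" using K(1) by (simp add: borel_compact)
  have [measurable]: "A - K \<in> sets borel" "U - A \<in> sets borel" using A U Kb by auto
  have "transl_diff (\<lambda>x. indicator A x *\<^sub>R c) z \<le> ennreal e" if z: "norm z < d" for z
  proof -
    have "ennreal \<bar>indicator A (z + x) *\<^sub>R c - indicator A x *\<^sub>R c\<bar> \<le> ennreal \<bar>c\<bar> * (?h (z + x) + ?h x)" for x
    proof (cases "indicator A (z + x) = (indicator A x :: real)")
      case False
      have "dist x (z + x) < d" "dist (z + x) x < d" using z by (auto simp: dist_norm)
      then have "?h (z + x) + ?h x \<ge> 1"
        using False d(2)[of x "z + x"] d(2)[of "z + x" x] by (auto simp: indicator_def split: if_splits)
      then have "ennreal \<bar>c\<bar> * 1 \<le> ennreal \<bar>c\<bar> * (?h (z + x) + ?h x)" by (intro mult_left_mono) auto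
      then show ?thesis using False by (auto simp: indicator_def split: if_splits)
    qed simp
    then have "transl_diff (\<lambda>x. indicator A x *\<^sub>R c) z \<le> (\<integral>\<^sup>+x. ennreal \<bar>c\<bar> * (?h (z + x) + ?h x) \<partial>lborel)"
      unfolding transl_diff_def by (intro nn_integral_mono) auto
    also have "\<dots> = ennreal \<bar>c\<bar> * ((\<integral>\<^sup>+x. ?h (z + x) \<partial>lborel) + (\<integral>\<^sup>+x. ?h x \<partial>lborel))"
      by (subst nn_integral_cmult, measurable, subst nn_integral_add) measurable
    also have "(\<integral>\<^sup>+x. ?h (z + x) \<partial>lborel) = (\<integral>\<^sup>+x. ?h x \<partial>lborel)"
      by (rule nn_integral_lborel_shift[of ?h]) measurable
    also have "(\<integral>\<^sup>+x. ?h x \<partial>lborel) = emeasure lborel (A - K) + emeasure lborel (U - A)"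
      by (subst nn_integral_add) auto
    also have "ennreal \<bar>c\<bar> * (\<dots> + \<dots>) \<le> ennreal \<bar>c\<bar> * ((ennreal e' + ennreal e') + (ennreal e' + ennreal e'))"
      using K(3) U(3) by (intro mult_left_mono add_mono) auto
    also have "\<dots> = ennreal (\<bar>c\<bar> * (4 * e'))"
      using e' by (simp flip: ennreal_plus ennreal_mult add: algebra_simps)
    also have "\<dots> \<le> ennreal e"
    proof (rule ennreal_leI)
      have "\<bar>c\<bar> * (4 * e') = e * (\<bar>c\<bar> / (\<bar>c\<bar> + 1))" by (simp add: e'_def field_simps)
      also have "\<dots> \<le> e * 1" using e by (intro mult_left_mono) (auto simp: divide_le_eq_1)
      finally show "\<bar>c\<bar> * (4 * e') \<le> e" by simp
    qed
    finally show ?thesis .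
  qed
  then show ?thesis using d(1) by (intro exI[of _ d] conjI allI impI)
qed

text \<open>Density argument from indicators via sums to limits. Translation invariance lets an
  approximation error enter twice, so it is made smaller than \<open>e / 4\<close>.\<close>

lemma transl_diff_small:
  fixes w :: "'a::euclidean_space \<Rightarrow> real"
  assumes "integrable lborel w" "0 < (e::real)"
  shows "\<exists>d>0. \<forall>z. norm z < d \<longrightarrow> transl_diff w z \<le> ennreal e"
  using assms
proof (induction arbitrary: e rule: integrable_induct)
  case (base A c)
  then show ?case using transl_diff_indicator[of A e c] by simp
next
  case (add f g)
  have [measurable]: "f \<in> borel_measurable borel" "g \<in> borel_measurable borel" using add by auto
  obtain d1 d2 where d: "d1 > 0" "\<And>z. norm z < d1 \<Longrightarrow> transl_diff f z \<le> ennreal (e / 2)"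
    "d2 > 0" "\<And>z. norm z < d2 \<Longrightarrow> transl_diff g z \<le> ennreal (e / 2)"
    using add.IH(1)[of "e / 2"] add.IH(2)[of "e / 2"] add.prems by auto
  have "transl_diff (\<lambda>x. f x + g x) z \<le> ennreal e" if z: "norm z < min d1 d2" for z
  proof -
    have "transl_diff (\<lambda>x. f x + g x) z \<le> (\<integral>\<^sup>+x. ennreal \<bar>f (z + x) - f x\<bar> + ennreal \<bar>g (z + x) - g x\<bar> \<partial>lborel)"
      unfolding transl_diff_def by (intro nn_integral_mono) (simp flip: ennreal_plus)
    also have "\<dots> = transl_diff f z + transl_diff g z"
      unfolding transl_diff_def by (subst nn_integral_add) auto
    also have "\<dots> \<le> ennreal (e / 2) + ennreal (e / 2)" using d z by (intro add_mono) auto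
    also have "\<dots> = ennreal e" using add.prems by (simp flip: ennreal_plus)
    finally show ?thesis .
  qed
  then show ?case using d by (intro exI[of _ "min d1 d2"]) auto
next
  case (lim f s)
  have M[measurable]: "f \<in> borel_measurable borel" "s i \<in> borel_measurable borel" for i
    using lim.hyps(1)[of i] lim.hyps(4) by auto
  \<comment> \<open>The induction rule supplies approximants with
    \<open>|s i| \<le> 2 * |f|\<close>, whence the dominating function
    \<open>3 * |f|\<close>.\<close>
  have "(\<lambda>i. LINT x|lborel. \<bar>f x - s i x\<bar>) \<longlonglongrightarrow> (LINT x|(lborel :: 'a measure). \<bar>0::real\<bar>)"
  proof (rule integral_dominated_convergence[where w = "\<lambda>x. 3 * \<bar>f x\<bar>"])
    show "integrable lborel (\<lambda>x. 3 * \<bar>f x\<bar>)" using lim.hyps(4) by auto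
    show "AE x in lborel. (\<lambda>i. \<bar>f x - s i x\<bar>) \<longlonglongrightarrow> \<bar>0\<bar>"
      using lim.hyps(2) by (intro AE_I2 tendsto_rabs) (auto intro!: tendsto_eq_intros)
    show "AE x in lborel. norm \<bar>f x - s i x\<bar> \<le> 3 * \<bar>f x\<bar>" for i
    proof (rule AE_I2)
      fix x :: 'a
      have "\<bar>s i x\<bar> \<le> 2 * \<bar>f x\<bar>" using lim.hyps(3)[of x i] by simp
      then show "norm \<bar>f x - s i x\<bar> \<le> 3 * \<bar>f x\<bar>" unfolding real_norm_def by linarith
    qed
  qed auto
  then have "(\<lambda>i. LINT x|lborel. \<bar>f x - s i x\<bar>) \<longlonglongrightarrow> 0" by simp
  then have "eventually (\<lambda>i. (LINT x|lborel. \<bar>f x - s i x\<bar>) < e / 4) sequentially"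
    by (rule order_tendstoD) (use lim.prems in simp)
  then obtain i where i: "(LINT x|lborel. \<bar>f x - s i x\<bar>) < e / 4" by (auto simp: eventually_sequentially)
  have "integrable lborel (\<lambda>x. \<bar>f x - s i x\<bar>)" using lim.hyps by auto
  then have ni: "(\<integral>\<^sup>+x. ennreal \<bar>f x - s i x\<bar> \<partial>lborel) \<le> ennreal (e / 4)"
    using i by (subst nn_integral_eq_integral) (auto intro: ennreal_leI)
  obtain d where d: "d > 0" "\<And>z. norm z < d \<Longrightarrow> transl_diff (s i) z \<le> ennreal (e / 2)"
    using lim.IH[of "e / 2" i] lim.prems by auto
  have "transl_diff f z \<le> ennreal e" if z: "norm z < d" for z
  proof -
    have "transl_diff f z \<le> transl_diff (s i) z + 2 * (\<integral>\<^sup>+x. ennreal \<bar>f x - s i x\<bar> \<partial>lborel)"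
      by (rule transl_diff_triangle) measurable
    also have "\<dots> \<le> ennreal (e / 2) + 2 * ennreal (e / 4)"
      using d z ni by (intro add_mono mult_left_mono) auto
    also have "2 * ennreal (e / 4) = ennreal (e / 2)"
    proof -
      have "2 * ennreal (e / 4) = ennreal 2 * ennreal (e / 4)" by simp
      also have "\<dots> = ennreal (e / 2)" using lim.prems by (subst ennreal_mult[symmetric]) auto
      finally show ?thesis .
    qed
    also have "ennreal (e / 2) + ennreal (e / 2) = ennreal e" using lim.prems by (simp flip: ennreal_plus)
    finally show ?thesis .
  qed
  then show ?case using d(1) by blast
qed

text \<open>For a kernel of mass one this dominates the distance from \<open>v x\<close> to the
  mollification at \<open>x\<close>. With the modulus inside, Tonelli's theorem applies.\<close>

definition local_osc ::
  "('n::finite \<Rightarrow> real \<Rightarrow> real) \<Rightarrow> real \<Rightarrow> (real ^ 'n \<Rightarrow> real) \<Rightarrow> real ^ 'n \<Rightarrow> ennreal" where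
  "local_osc g s v x = (\<integral>\<^sup>+y. ennreal (\<bar>kern s x g y\<bar> * \<bar>v y - v x\<bar>) \<partial>lborel)"

text \<open>After the substitution \<open>y = x + z\<close> and an exchange of integrals, the inner
  integral is the modulus of continuity in the mean at \<open>z\<close>. This is uniformly small for
  \<open>|z| < s\<close>, while the kernels are bounded in the mean independently of
  \<open>s\<close>.\<close>

lemma local_osc_small:
  fixes v :: "real ^ 'n \<Rightarrow> real"
  assumes g: "\<And>i. cbump d (g i)" and d: "d * real CARD('n) < 1"
    and v[measurable]: "v \<in> borel_measurable borel"
    and vi: "\<And>R. set_integrable lborel (ball 0 R) v"
    and e: "0 < (e::real)"
  shows "\<exists>s0>0. \<forall>s. 0 < s \<and> s < s0 \<longrightarrow> (\<integral>\<^sup>+x. local_osc g s v x * indicator (ball 0 R) x \<partial>lborel) \<le> ennreal e"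
proof -
  have "\<forall>i. \<exists>B\<ge>0. \<forall>t. \<bar>g i t\<bar> \<le> B" using cbump_bounded[OF g] by blast
  then obtain Bi where Bi: "\<And>i. Bi i \<ge> 0" "\<And>i t. \<bar>g i t\<bar> \<le> Bi i" by metis
  define B where "B = (\<Sum>i\<in>UNIV. Bi i)"
  have Bi_le: "Bi i \<le> B" for i unfolding B_def using Bi by (intro member_le_sum) auto
  have B: "\<bar>g i t\<bar> \<le> B" "B \<ge> 0" for i t
    using order_trans[OF Bi(2) Bi_le] order_trans[OF Bi(1) Bi_le] by blast+
  have gm[measurable]: "g i \<in> borel_measurable borel" for i
    using g by (auto simp: cbump_def intro: smooth_borel_measurable)
  \<comment> \<open>For \<open>s < 1\<close> and \<open>x\<close> in the ball of radius
    \<open>R\<close>, the kernel does not reach beyond radius \<open>R + 1\<close>, so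
    \<open>v\<close> may be replaced by an integrable truncation.\<close>
  define w where "w x = indicator (ball 0 (R + 1)) x *\<^sub>R v x" for x
  have wi: "integrable lborel w" using vi[of "R + 1"] by (simp add: w_def[abs_def] set_integrable_def)
  have [measurable]: "w \<in> borel_measurable borel" using wi by simp
  \<comment> \<open>Up to the 1 that makes it positive, \<open>V\<close> is the sup bound
    \<open>(B / s)^N\<close> of the kernel times the volume of the ball of radius \<open>s\<close>;
    the powers of \<open>s\<close> cancel.\<close>
  define V where "V = unit_ball_vol (real CARD('n)) * B ^ CARD('n) + 1"
  have V: "V > 0" unfolding V_def using B(2) by (intro add_nonneg_pos mult_nonneg_nonneg) auto
  obtain s1 where s1: "s1 > 0" "\<And>z. norm z < s1 \<Longrightarrow> transl_diff w z \<le> ennreal (e / V)"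
    using transl_diff_small[OF wi, of "e / V"] e V by auto
  have "(\<integral>\<^sup>+x. local_osc g s v x * indicator (ball 0 R) x \<partial>lborel) \<le> ennreal e"
    if s: "0 < s" "s < min s1 1" for s
  proof -
    have km[measurable]: "kern s 0 g \<in> borel_measurable borel"
      unfolding kern_def by measurable
    have "local_osc g s v x * indicator (ball 0 R) x \<le> (\<integral>\<^sup>+z. ennreal (\<bar>kern s 0 g z\<bar> * \<bar>w (z + x) - w x\<bar>) \<partial>lborel)" for x
    proof (cases "x \<in> ball 0 R")
      case True
      have "local_osc g s v x = (\<integral>\<^sup>+y. ennreal (\<bar>kern s 0 g (y - x)\<bar> * \<bar>v y - v x\<bar>) \<partial>lborel)"
        unfolding local_osc_def by (subst kern_shift) simp
      also have "\<dots> = (\<integral>\<^sup>+z. ennreal (\<bar>kern s 0 g (x + z - x)\<bar> * \<bar>v (x + z) - v x\<bar>) \<partial>lborel)"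
        by (rule nn_integral_lborel_shift[symmetric]) measurable
      also have "\<dots> \<le> (\<integral>\<^sup>+z. ennreal (\<bar>kern s 0 g z\<bar> * \<bar>w (z + x) - w x\<bar>) \<partial>lborel)"
      proof (intro nn_integral_mono ennreal_leI)
        fix z :: "real ^ 'n"
        show "\<bar>kern s 0 g (x + z - x)\<bar> * \<bar>v (x + z) - v x\<bar> \<le> \<bar>kern s 0 g z\<bar> * \<bar>w (z + x) - w x\<bar>"
        proof (cases "kern s 0 g z = 0")
          case False
          then have "norm z < s" using kern_support[where g = g, OF g s(1) d] by force
          then have "x + z \<in> ball 0 (R + 1)" "x \<in> ball 0 (R + 1)"
            using True s norm_triangle_ineq[of x z] by auto
          then show ?thesis by (simp add: w_def add.commute)
        qed simp
      qed
      finally show ?thesis using True by simp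
    qed simp
    then have "(\<integral>\<^sup>+x. local_osc g s v x * indicator (ball 0 R) x \<partial>lborel)
        \<le> (\<integral>\<^sup>+x. (\<integral>\<^sup>+z. ennreal (\<bar>kern s 0 g z\<bar> * \<bar>w (z + x) - w x\<bar>) \<partial>lborel) \<partial>lborel)"
      by (intro nn_integral_mono)
    also have "\<dots> = (\<integral>\<^sup>+z. (\<integral>\<^sup>+x. ennreal (\<bar>kern s 0 g z\<bar> * \<bar>w (z + x) - w x\<bar>) \<partial>lborel) \<partial>lborel)"
      by (rule lborel_pair.Fubini') measurable
    also have "\<dots> = (\<integral>\<^sup>+z. ennreal \<bar>kern s 0 g z\<bar> * transl_diff w z \<partial>lborel)"
      unfolding transl_diff_def
      by (subst nn_integral_cmult[symmetric], measurable) (simp add: ennreal_mult)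
    also have "\<dots> \<le> (\<integral>\<^sup>+z. ennreal ((B / s) ^ CARD('n)) * ennreal (e / V) * indicator (ball (0 :: real ^ 'n) s) z \<partial>lborel)"
    proof (intro nn_integral_mono)
      fix z :: "real ^ 'n"
      show "ennreal \<bar>kern s 0 g z\<bar> * transl_diff w z \<le> ennreal ((B / s) ^ CARD('n)) * ennreal (e / V) * indicator (ball 0 s) z"
      proof (cases "kern s 0 g z = 0")
        case False
        then have z: "z \<in> ball 0 s" using kern_support[where g = g, OF g s(1) d] by blast
        have "ennreal \<bar>kern s 0 g z\<bar> * transl_diff w z \<le> ennreal ((B / s) ^ CARD('n)) * ennreal (e / V)"
          using z s s1(2)[of z] kern_bound[where g = g, OF B(1) s(1)] by (intro mult_mono ennreal_leI) auto
        then show ?thesis using z by simp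
      qed simp
    qed
    also have "\<dots> = ennreal ((B / s) ^ CARD('n)) * ennreal (e / V) * emeasure lborel (ball (0 :: real ^ 'n) s)"
      by (subst nn_integral_cmult_indicator) auto
    also have "\<dots> = ennreal ((B / s) ^ CARD('n) * (e / V) * (unit_ball_vol (real CARD('n)) * s ^ CARD('n)))"
      using s B(2) e V by (subst emeasure_ball) (auto simp flip: ennreal_mult)
    also have "\<dots> \<le> ennreal e"
    proof (rule ennreal_leI)
      have "(B / s) ^ CARD('n) * (e / V) * (unit_ball_vol (real CARD('n)) * s ^ CARD('n))
         = e * ((unit_ball_vol (real CARD('n)) * B ^ CARD('n)) / V)"
        using s by (simp add: power_divide)
      also have "\<dots> \<le> e * 1"
        using e V by (intro mult_left_mono) (auto simp: V_def)
      finally show "(B / s) ^ CARD('n) * (e / V) * (unit_ball_vol (real CARD('n)) * s ^ CARD('n)) \<le> e" by simp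
    qed
    finally show ?thesis .
  qed
  then show ?thesis using s1(1) by (intro exI[of _ "min s1 1"]) auto
qed

section \<open>Locally integrable functions tested with kernels\<close>

lemma locally_integrable_cball:
  assumes "locally_integrable u"
  shows "integrable lebesgue (\<lambda>y. indicator (cball x s) y *\<^sub>R u y)"
  using assms compact_cball unfolding locally_integrable_def set_integrable_def by blast

lemma locally_integrable_measurable:
  assumes "locally_integrable u"
  shows "u \<in> borel_measurable lebesgue"
proof (rule borel_measurable_LIMSEQ_real)
  show "(\<lambda>y. indicator (cball 0 (real i)) y *\<^sub>R u y) \<in> borel_measurable lebesgue" for i
    by (rule borel_measurable_integrable[OF locally_integrable_cball[OF assms]])
  fix y :: "real ^ 'a"
  obtain m :: nat where m: "norm y \<le> real m" using real_arch_simple by blast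
  have "\<forall>\<^sub>F i in sequentially. indicator (cball 0 (real i)) y *\<^sub>R u y = u y"
    unfolding eventually_sequentially
    by (rule exI[of _ m]) (use m in \<open>auto simp: indicator_def\<close>)
  then show "(\<lambda>i. indicator (cball 0 (real i)) y *\<^sub>R u y) \<longlonglongrightarrow> u y"
    by (rule tendsto_eventually)
qed

lemma locally_integrable_mult:
  assumes u: "locally_integrable u" and p: "p \<in> borel_measurable borel" "\<And>y. \<bar>p y\<bar> \<le> M"
    and supp: "\<And>y. p y \<noteq> 0 \<Longrightarrow> y \<in> ball x s"
  shows "integrable lebesgue (\<lambda>y. u y * p y)"
proof -
  note i = locally_integrable_cball[OF u, of x s]
  have "integrable lebesgue (\<lambda>y. M * (indicator (cball x s) y *\<^sub>R u y))" using i by simp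
  moreover have "(\<lambda>y. u y * p y) = (\<lambda>y. (indicator (cball x s) y *\<^sub>R u y) * p y)"
  proof
    fix y show "u y * p y = (indicator (cball x s) y *\<^sub>R u y) * p y"
      using supp[of y] by (cases "p y = 0") (auto simp: indicator_def)
  qed
  moreover have "(\<lambda>y. (indicator (cball x s) y *\<^sub>R u y) * p y) \<in> borel_measurable lebesgue"
    by (intro borel_measurable_times borel_measurable_integrable[OF i] measurable_completion) (use p in simp)
  moreover have "norm (indicator (cball x s) y *\<^sub>R u y * p y) \<le> norm (M * (indicator (cball x s) y *\<^sub>R u y))" for y
    using p(2)[of y] by (auto simp: indicator_def abs_mult mult.commute intro!: mult_right_mono)
  ultimately show ?thesis by (metis (no_types, lifting) Bochner_Integration.integrable_bound AE_I2)
qed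

lemma kern_mult_integrable:
  fixes x :: "real ^ 'n"
  assumes "locally_integrable u" "\<And>i. cbump d (g i)" "0 < s" "d * real CARD('n) < 1"
  shows "integrable lebesgue (\<lambda>y. u y * kern s x g y)"
proof -
  have "\<forall>i. \<exists>B\<ge>0. \<forall>t. \<bar>g i t\<bar> \<le> B" using cbump_bounded[OF assms(2)] by blast
  then obtain Bi where Bi: "\<And>i. Bi i \<ge> 0" "\<And>i t. \<bar>g i t\<bar> \<le> Bi i" by metis
  have "Bi i \<le> (\<Sum>i\<in>UNIV. Bi i)" for i using Bi by (intro member_le_sum) auto
  then have B: "\<bar>g i t\<bar> \<le> (\<Sum>i\<in>UNIV. Bi i)" for i t using Bi(2) order_trans by blast
  show ?thesis
    by (rule locally_integrable_mult[OF assms(1) kern_borel kern_bound[where g = g, OF B assms(3)] kern_support[OF assms(2-4)]])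
      (use assms(2) in \<open>auto simp: cbump_def\<close>)
qed

text \<open>This takes the place of the Lebesgue differentiation theorem. Since the bound
  \<open>Q\<close> holds for all late \<open>j\<close>, the positive part of \<open>|v| - Q\<close>
  is at most the distance from \<open>v\<close> to its mollification, whose integral over any ball
  tends to zero. Convergence in the mean is enough.\<close>

lemma AE_le_of_mollified:
  fixes v :: "real ^ 'n \<Rightarrow> real"
  assumes v: "locally_integrable v"
    and h: "\<And>i. cbump d (h i)" "(\<Prod>i\<in>UNIV. LINT t|lborel. h i t) = 1"
    and d: "d * real CARD('n) < 1"
    and s: "\<And>j. 0 < s j" "s \<longlonglongrightarrow> 0"
    and Q: "Q \<in> borel_measurable lebesgue"
    and bound: "AE x in lebesgue. \<forall>j\<ge>n. \<bar>LINT y|lebesgue. v y * kern (s j) x h y\<bar> \<le> Q x"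
  shows "AE x in lebesgue. \<bar>v x\<bar> \<le> Q x"
proof -
  have vm: "v \<in> borel_measurable lebesgue" by (rule locally_integrable_measurable[OF v])
  \<comment> \<open>Translation and Tonelli were used on \<open>lborel\<close>, which calls for a
    Borel representative.\<close>
  obtain v' where v'[measurable]: "v' \<in> borel_measurable borel" and eq: "AE x in lborel. v x = v' x"
    using completion_ex_borel_measurable_real[OF vm] by auto
  have eqL: "AE x in lebesgue. v x = v' x" using eq by (rule AE_completion)
  have v'int: "set_integrable lborel (ball 0 R) v'" for R
  proof -
    note i = locally_integrable_cball[OF v, of 0 R]
    have m: "(\<lambda>y. indicator (ball 0 R) y *\<^sub>R v' y) \<in> borel_measurable borel"
      by (intro borel_measurable_scaleR borel_measurable_indicator v') simp
    have "integrable lebesgue (\<lambda>y. indicator (ball 0 R) y *\<^sub>R v' y)"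
    proof (rule Bochner_Integration.integrable_bound[OF i])
      show "(\<lambda>y. indicator (ball 0 R) y *\<^sub>R v' y) \<in> borel_measurable lebesgue"
        by (intro measurable_completion) (use m in simp)
      show "AE y in lebesgue. norm (indicator (ball 0 R) y *\<^sub>R v' y) \<le> norm (indicator (cball 0 R) y *\<^sub>R v y)"
        using eqL by eventually_elim (auto simp: indicator_def)
    qed
    then show ?thesis unfolding set_integrable_def by (subst (asm) integrable_completion) (use m in auto)
  qed
  have sm: "smooth (h i)" for i using h(1) by (simp add: cbump_def)
  have osc: "ennreal \<bar>v' x - (LINT y|lebesgue. v y * kern (s j) x h y)\<bar> \<le> local_osc h (s j) v' x" for x j
  proof -
    let ?k = "kern (s j) x h"
    have [measurable]: "?k \<in> borel_measurable borel" by (rule kern_borel[OF sm])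
    have i1: "integrable lebesgue (\<lambda>y. v y * ?k y)" by (rule kern_mult_integrable[OF v h(1) s(1) d])
    have "integrable lebesgue (\<lambda>y. v' y * ?k y)"
    proof (rule Bochner_Integration.integrable_bound[OF i1])
      show "(\<lambda>y. v' y * ?k y) \<in> borel_measurable lebesgue" by (intro measurable_completion) simp
      show "AE y in lebesgue. norm (v' y * ?k y) \<le> norm (v y * ?k y)"
        using eqL by eventually_elim simp
    qed
    then have i2: "integrable lborel (\<lambda>y. v' y * ?k y)" by (subst (asm) integrable_completion) auto
    have i3: "integrable lborel (\<lambda>y. v' x * ?k y)" using kern_integrable[where g = h, OF h(1) s(1)] by simp
    have "(LINT y|lebesgue. v y * ?k y) = (LINT y|lebesgue. v' y * ?k y)"
    proof (rule integral_cong_AE)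
      show "(\<lambda>y. v' y * ?k y) \<in> borel_measurable lebesgue" by (intro measurable_completion) simp
      show "AE y in lebesgue. v y * ?k y = v' y * ?k y" using eqL by eventually_elim simp
    qed (use i1 in auto)
    also have "\<dots> = (LINT y|lborel. v' y * ?k y)" by (rule integral_completion) simp
    finally have "v' x - (LINT y|lebesgue. v y * ?k y) = (LINT y|lborel. v' x * ?k y) - (LINT y|lborel. v' y * ?k y)"
      using kern_integral[where g = h and x = x, OF h(1) s(1), of j] h(2) by simp
    also have "\<dots> = (LINT y|lborel. v' x * ?k y - v' y * ?k y)" by (rule Bochner_Integration.integral_diff[OF i3 i2, symmetric])
    finally have "ennreal \<bar>v' x - (LINT y|lebesgue. v y * ?k y)\<bar> \<le> (\<integral>\<^sup>+y. norm (v' x * ?k y - v' y * ?k y) \<partial>lborel)"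
      using integral_norm_bound_ennreal[OF Bochner_Integration.integrable_diff[OF i3 i2]] by simp
    also have "\<dots> = local_osc h (s j) v' x"
      unfolding local_osc_def
      by (intro nn_integral_cong arg_cong[where f = ennreal])
        (simp add: abs_mult[symmetric] abs_minus_commute left_diff_distrib mult.commute)
    finally show ?thesis .
  qed
  \<comment> \<open>Since \<open>ennreal\<close> sends negative numbers to 0, \<open>F\<close> is
    the positive part.\<close>
  define F where "F x = ennreal (\<bar>v' x\<bar> - Q x)" for x
  have Fm: "F \<in> borel_measurable lebesgue"
  proof -
    have [measurable]: "v' \<in> borel_measurable lebesgue" "Q \<in> borel_measurable lebesgue"
      using v' Q by (auto intro: measurable_completion)
    show ?thesis unfolding F_def by measurable
  qed
  have "AE x in lebesgue. x \<in> ball 0 (real R) \<longrightarrow> F x = 0" for R :: nat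
  proof -
    have small: "(\<integral>\<^sup>+x. F x * indicator (ball 0 (real R)) x \<partial>lebesgue) \<le> ennreal e" if e: "e > 0" for e :: real
    proof -
      have "\<exists>s0>0. \<forall>s. 0 < s \<and> s < s0 \<longrightarrow>
          (\<integral>\<^sup>+x. local_osc h s v' x * indicator (ball 0 (real R)) x \<partial>lborel) \<le> ennreal e"
        by (rule local_osc_small[where g = h, OF h(1) d v' v'int e])
      then obtain s0 where s0: "s0 > 0" "\<forall>s. 0 < s \<and> s < s0 \<longrightarrow>
          (\<integral>\<^sup>+x. local_osc h s v' x * indicator (ball 0 (real R)) x \<partial>lborel) \<le> ennreal e"
        by (elim exE conjE)
      have "eventually (\<lambda>j. s j < s0) sequentially" using order_tendstoD(2)[OF s(2) s0(1)] .
      then have "eventually (\<lambda>j. s j < s0 \<and> j \<ge> n) sequentially" using eventually_ge_at_top by (rule eventually_conj)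
      then obtain j where j: "s j < s0" "j \<ge> n" by (auto simp: eventually_sequentially)
      have "AE x in lebesgue. F x * indicator (ball 0 (real R)) x \<le> local_osc h (s j) v' x * indicator (ball 0 (real R)) x"
        using bound
      proof eventually_elim
        case (elim x)
        have "F x \<le> ennreal \<bar>v' x - (LINT y|lebesgue. v y * kern (s j) x h y)\<bar>"
          unfolding F_def using elim j(2) by (intro ennreal_leI) force
        then show ?case using osc[of x j] by (intro mult_right_mono) auto
      qed
      then have "(\<integral>\<^sup>+x. F x * indicator (ball 0 (real R)) x \<partial>lebesgue)
          \<le> (\<integral>\<^sup>+x. local_osc h (s j) v' x * indicator (ball 0 (real R)) x \<partial>lebesgue)"
        by (rule nn_integral_mono_AE)
      also have "\<dots> \<le> ennreal e" using s0(2) s(1) j(1) by (simp add: nn_integral_completion)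
      finally show ?thesis .
    qed
    have "(\<integral>\<^sup>+x. F x * indicator (ball 0 (real R)) x \<partial>lebesgue) \<le> 0"
      by (rule ennreal_le_epsilon) (use small in auto)
    then have "(\<integral>\<^sup>+x. F x * indicator (ball 0 (real R)) x \<partial>lebesgue) = 0" by simp
    then have "AE x in lebesgue. F x * indicator (ball 0 (real R)) x = 0"
      using Fm by (subst (asm) nn_integral_0_iff_AE) (auto intro!: borel_measurable_times_ennreal borel_measurable_indicator)
    then show ?thesis by eventually_elim (auto simp: indicator_def split: if_splits)
  qed
  then have "AE x in lebesgue. \<forall>R::nat. x \<in> ball 0 (real R) \<longrightarrow> F x = 0"
    by (subst AE_all_countable) (rule allI)
  with eqL show ?thesis
  proof eventually_elim
    case (elim x)
    obtain R :: nat where "norm x < real R" using reals_Archimedean2 by blast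
    then have "F x = 0" using elim(2) by auto
    then show ?case using elim(1) by (simp add: F_def ennreal_eq_0_iff)
  qed
qed

subsection \<open>Mollified weak derivatives\<close>

lemma finite_lists_of_length: "finite {is :: 'n::finite list. length is = j}"
  using finite_lists_length_eq[of "UNIV :: 'n set" j] by simp

lemma tensor_norm_eq_L2_set: "tensor_norm j T = L2_set T {is. length is = j}"
  by (simp add: tensor_norm_def L2_set_def)

lemma abs_le_tensor_norm: "length is = j \<Longrightarrow> \<bar>T is\<bar> \<le> tensor_norm j T"
  unfolding tensor_norm_eq_L2_set
  using member_le_L2_set[of "{is. length is = j}" "is" "\<lambda>is. \<bar>T is\<bar>"] finite_lists_of_length[of j]
  by (simp add: L2_set_def)

lemma tensor_norm_le_sum: "tensor_norm j T \<le> (\<Sum>is | length is = j. \<bar>T is\<bar>)"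
  unfolding tensor_norm_eq_L2_set by (rule L2_set_le_sum_abs)

lemma tensor_norm_nonneg: "0 \<le> tensor_norm j T"
  by (simp add: tensor_norm_def sum_nonneg)

lemma polys_deg_less_borel: "P \<in> polys_deg_less l \<Longrightarrow> P \<in> borel_measurable borel"
proof -
  assume "P \<in> polys_deg_less l"
  then obtain c where "P = (\<lambda>x. \<Sum>\<alpha> | (\<Sum>i\<in>UNIV. \<alpha> i) < l. c \<alpha> * (\<Prod>i\<in>UNIV. (x $ i) ^ \<alpha> i))"
    by (auto simp: polys_deg_less_def)
  then show ?thesis
    by (auto intro!: borel_measurable_continuous_onI continuous_intros)
qed

lemma emeasure_lebesgue_ball:
  "0 \<le> s \<Longrightarrow> emeasure lebesgue (ball (x :: real ^ 'n) s) = ennreal (unit_ball_vol (real CARD('n)) * s ^ CARD('n))"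
  by (simp add: emeasure_ball)

text \<open>Needed to test the weak derivative of order \<open>l\<close> with a kernel that already
  carries further derivatives.\<close>

lemma test_function_iter_partial_kern:
  assumes "\<And>i. cbump d (g i)" "0 < s"
  shows "test_function (iter_partial is (kern s x g))"
proof -
  have sm: "smooth (\<lambda>t. 1 / s * g i (1 / s * t + (- x $ i / s)))" for i
    using cbump_affine[OF assms] by (simp add: cbump_def)
  show ?thesis
    unfolding kern_eq_tprod iter_partial_tprod[OF sm]
    by (rule test_function_tprod, rule cbump_higher_deriv, rule cbump_affine[OF assms])
qed

lemma abs_integral_mult_le:
  fixes f k :: "'a \<Rightarrow> real"
  assumes int: "integrable M (\<lambda>y. f y * k y)" and f: "f \<in> borel_measurable M"
    and B: "B \<in> sets M" "\<And>y. k y \<noteq> 0 \<Longrightarrow> y \<in> B" and c: "\<And>y. \<bar>k y\<bar> \<le> c"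
  shows "ennreal \<bar>LINT y|M. f y * k y\<bar> \<le> ennreal c * (\<integral>\<^sup>+y\<in>B. ennreal \<bar>f y\<bar> \<partial>M)"
proof -
  have c0: "0 \<le> c" using c[of undefined] by linarith
  have "ennreal \<bar>LINT y|M. f y * k y\<bar> \<le> (\<integral>\<^sup>+y. norm (f y * k y) \<partial>M)"
    using integral_norm_bound_ennreal[OF int] by simp
  also have "\<dots> \<le> (\<integral>\<^sup>+y. ennreal c * (ennreal \<bar>f y\<bar> * indicator B y) \<partial>M)"
  proof (rule nn_integral_mono)
    fix y
    show "ennreal (norm (f y * k y)) \<le> ennreal c * (ennreal \<bar>f y\<bar> * indicator B y)"
    proof (cases "k y = 0")
      case False
      have "\<bar>f y\<bar> * \<bar>k y\<bar> \<le> c * \<bar>f y\<bar>" using c[of y] mult_left_mono[of "\<bar>k y\<bar>" c "\<bar>f y\<bar>"] by (simp add: mult.commute)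
      then show ?thesis
        using B(2)[OF False] c0 by (simp add: abs_mult ennreal_mult[symmetric] ennreal_leI)
    qed simp
  qed
  also have "\<dots> = ennreal c * (\<integral>\<^sup>+y\<in>B. ennreal \<bar>f y\<bar> \<partial>M)"
    using f B(1) by (intro nn_integral_cmult) auto
  finally show ?thesis .
qed

text \<open>The \<open>l\<close> derivatives cost \<open>(1 / s)^l\<close>, and
  \<open>(B / s)^N\<close> bounds the differentiated kernel; the sign from the weak derivative
  disappears in the modulus.\<close>

lemma mollified_weak_deriv_le_polynomial:
  fixes u :: "real ^ 'n \<Rightarrow> real"
  assumes wd: "has_weak_deriv l u v" and l: "length is = l"
    and h: "\<And>i. cbump d (h i)" and d: "d * real CARD('n) < 1" and s: "0 < s"
    and B: "\<And>i t. \<bar>(deriv ^^ count_list is i) (h i) t\<bar> \<le> B"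
    and P: "P \<in> polys_deg_less l"
  shows "ennreal \<bar>LINT y|lebesgue. v y is * kern s x h y\<bar>
    \<le> ennreal ((1 / s) ^ l * (B / s) ^ CARD('n)) * (\<integral>\<^sup>+y\<in>ball x s. ennreal \<bar>u y - P y\<bar> \<partial>lebesgue)"
proof -
  let ?k = "kern s x (\<lambda>i. (deriv ^^ count_list is i) (h i))"
  let ?\<phi> = "iter_partial is (kern s x h)"
  have sm: "smooth (h i)" for i using h by (simp add: cbump_def)
  have \<phi>: "?\<phi> y = (1 / s) ^ l * ?k y" for y using iter_partial_kern[where g = h, OF sm, of "is" s x y] l by simp
  have u: "locally_integrable u" using wd by (simp add: has_weak_deriv_def)
  have km[measurable]: "?k \<in> borel_measurable borel" by (rule kern_borel[OF smooth_higher_deriv[OF sm]])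
  have Pm[measurable]: "P \<in> borel_measurable borel" by (rule polys_deg_less_borel[OF P])
  have h': "cbump d ((deriv ^^ count_list is i) (h i))" for i by (rule cbump_higher_deriv[OF h])
  have iu: "integrable lebesgue (\<lambda>y. u y * ?\<phi> y)"
    unfolding \<phi>
    using integrable_mult_right[where c = "(1 / s) ^ l", OF kern_mult_integrable[where g = "\<lambda>i. (deriv ^^ count_list is i) (h i)" and x = x, OF u h' s d]]
    by (simp only: mult.left_commute)
  have Pk: "(\<lambda>y. P y * ?\<phi> y) \<in> borel_measurable lborel" unfolding \<phi> by simp
  have iP: "integrable lebesgue (\<lambda>y. P y * ?\<phi> y)"
    using polys_deg_less_orthogonal_kern(1)[where g = h and x = x, OF h s, of P "is"] P l
    by (subst integrable_completion[OF Pk]) simp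
  have P0: "(LINT y|lebesgue. P y * ?\<phi> y) = 0"
    using polys_deg_less_orthogonal_kern(2)[where g = h and x = x, OF h s, of P "is"] P l
    by (subst integral_completion[OF Pk]) simp
  have eq: "(\<lambda>y. u y * ?\<phi> y - P y * ?\<phi> y) = (\<lambda>y. (u y - P y) * ?\<phi> y)"
    by (simp add: left_diff_distrib)
  have "\<bar>LINT y|lebesgue. v y is * kern s x h y\<bar> = \<bar>LINT y|lebesgue. u y * ?\<phi> y\<bar>"
    using wd l test_function_kern[where g = h and x = x, OF h s]
    by (auto simp: has_weak_deriv_def abs_mult)
  also have "(LINT y|lebesgue. u y * ?\<phi> y) = (LINT y|lebesgue. (u y - P y) * ?\<phi> y)"
    using Bochner_Integration.integral_diff[OF iu iP] P0 eq by simp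
  finally have "ennreal \<bar>LINT y|lebesgue. v y is * kern s x h y\<bar> = ennreal \<bar>LINT y|lebesgue. (u y - P y) * ?\<phi> y\<bar>"
    by simp
  also have "\<dots> \<le> ennreal ((1 / s) ^ l * (B / s) ^ CARD('n)) * (\<integral>\<^sup>+y\<in>ball x s. ennreal \<bar>u y - P y\<bar> \<partial>lebesgue)"
  proof (rule abs_integral_mult_le)
    show "integrable lebesgue (\<lambda>y. (u y - P y) * ?\<phi> y)"
      using Bochner_Integration.integrable_diff[OF iu iP] eq by simp
    show "(\<lambda>y. u y - P y) \<in> borel_measurable lebesgue"
      using locally_integrable_measurable[OF u] measurable_completion[of P lborel borel] Pm by simp
    show "\<bar>?\<phi> y\<bar> \<le> (1 / s) ^ l * (B / s) ^ CARD('n)" for y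
      unfolding \<phi> using s kern_bound[where g = "\<lambda>i. (deriv ^^ count_list is i) (h i)" and x = x and y = y, OF B s]
      by (auto simp: abs_mult power_abs intro!: mult_left_mono divide_right_mono)
    show "y \<in> ball x s" if "?\<phi> y \<noteq> 0" for y
      using that kern_support[where g = "\<lambda>i. (deriv ^^ count_list is i) (h i)" and x = x and y = y, OF h' s d] unfolding \<phi> by auto
  qed simp
  finally show ?thesis .
qed

lemma mollified_weak_deriv_le_campanato:
  fixes u :: "real ^ 'n \<Rightarrow> real"
  assumes wd: "has_weak_deriv l u v" and l: "length is = l"
    and h: "\<And>i. cbump d (h i)" and d: "d * real CARD('n) < 1" and s: "0 < s" "s < \<rho>"
    and B: "\<And>i t. \<bar>(deriv ^^ count_list is i) (h i) t\<bar> \<le> B" "0 < B"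
    and fin: "campanato_seminorm l \<rho> lam u < \<infinity>"
  shows "\<bar>LINT y|lebesgue. v y is * kern s x h y\<bar>
    \<le> B ^ CARD('n) * unit_ball_vol (real CARD('n)) * s powr (- (real l + lam)) * enn2real (campanato_seminorm l \<rho> lam u)"
proof -
  let ?E = "\<bar>LINT y|lebesgue. v y is * kern s x h y\<bar>"
  let ?V = "unit_ball_vol (real CARD('n))"
  let ?A = "enn2real (campanato_seminorm l \<rho> lam u)"
  let ?I = "\<lambda>P. \<integral>\<^sup>+y\<in>ball x s. ennreal \<bar>u y - P y\<bar> \<partial>lebesgue"
  let ?J = "INF P\<in>polys_deg_less l. ?I P / emeasure lebesgue (ball x s)"
  have V: "0 < ?V" "?V \<noteq> 0"
    using unit_ball_vol_pos[of "real CARD('n)"] by (simp_all only: of_nat_0_le_iff less_imp_neq[symmetric] simp_thms)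
  \<comment> \<open>What remains of the kernel bound once the integral over the ball is turned into
    a mean: the volume contributes \<open>unit_ball_vol\<close> and cancels
    \<open>s^N\<close>.\<close>
  define c where "c = (1 / s) ^ l * B ^ CARD('n) * ?V"
  have c: "0 < c" using s B V by (simp add: c_def)
  have m: "?V * s ^ CARD('n) > 0" using s V by simp
  have "ennreal (?E / c) \<le> ?J"
  proof (rule INF_greatest)
    fix P :: "real ^ 'n \<Rightarrow> real" assume P: "P \<in> polys_deg_less l"
    show "ennreal (?E / c) \<le> ?I P / emeasure lebesgue (ball x s)"
    proof (cases "?I P")
      case (real r)
      have "ennreal ?E \<le> ennreal ((1 / s) ^ l * (B / s) ^ CARD('n) * r)"
        using mollified_weak_deriv_le_polynomial[where h = h and x = x, OF wd l h d s(1) B(1) P] real s B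
        by (simp add: ennreal_mult[symmetric])
      then have "?E \<le> (1 / s) ^ l * (B / s) ^ CARD('n) * r"
        using real(1) s B(2) by (subst (asm) ennreal_le_iff) auto
      also have "\<dots> = c * (r / (?V * s ^ CARD('n)))"
        using s V by (simp add: c_def power_divide)
      finally have "?E / c \<le> r / (?V * s ^ CARD('n))" using c by (simp add: pos_divide_le_eq mult.commute)
      then show ?thesis
        using real s m by (simp add: emeasure_lebesgue_ball divide_ennreal del: emeasure_completion)
    next
      case top
      then show ?thesis using s by (simp add: emeasure_lebesgue_ball ennreal_top_divide del: emeasure_completion)
    qed
  qed
  then have "ennreal (s powr lam) * ennreal (?E / c) \<le> ennreal (s powr lam) * ?J"
    by (rule mult_left_mono) simp
  \<comment> \<open>Here \<open>s < \<rho>\<close> enters: the ball of radius \<open>s\<close>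
    around \<open>x\<close> competes in the supremum.\<close>
  also have "\<dots> \<le> campanato_seminorm l \<rho> lam u"
    unfolding campanato_seminorm_def
    by (rule SUP_upper2[of x], simp, rule SUP_upper2[of s]) (use s in auto)
  also have "\<dots> = ennreal ?A" using fin by (simp add: ennreal_enn2real_if)
  finally have "s powr lam * (?E / c) \<le> ?A"
    using c by (simp add: ennreal_mult[symmetric])
  then have "?E * s powr lam \<le> ?A * c" using c by (simp add: pos_divide_le_eq mult.commute)
  then have "?E * (s powr lam * s powr (- lam)) \<le> ?A * c * s powr (- lam)"
    by (simp add: mult.assoc[symmetric] mult_right_mono)
  then have "?E \<le> ?A * c * s powr (- lam)" using s by (simp add: powr_add[symmetric])
  also have "\<dots> = B ^ CARD('n) * ?V * s powr (- (real l + lam)) * ?A"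
  proof -
    have "s powr (- (real l + lam)) = s powr (- real l) * s powr (- lam)" by (simp add: powr_add[symmetric])
    also have "s powr (- real l) = (1 / s) ^ l"
      using s by (simp add: powr_minus powr_realpow power_one_over divide_inverse power_inverse)
    finally show ?thesis by (simp add: c_def)
  qed
  finally show ?thesis .
qed

text \<open>Instead of Hoelder's inequality, \<open>F \<le> t + t powr (1 - p) * F powr p\<close> is used, with
  \<open>t = s powr \<sigma> * G\<close>.\<close>

lemma ball_integral_le_fractional:
  fixes x :: "real ^ 'n"
  assumes F[measurable]: "F \<in> borel_measurable lebesgue" and F0: "\<And>y. 0 \<le> F y" "F x = 0"
    and p: "1 \<le> p" and s: "0 < s" and \<sigma>: "0 < \<sigma>" and G: "0 \<le> G"
    and le: "(\<integral>\<^sup>+y. ennreal (F y powr p / norm (x - y) powr (real CARD('n) + \<sigma> * p)) \<partial>lebesgue) \<le> ennreal (G powr p)"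
  shows "(\<integral>\<^sup>+y\<in>ball x s. ennreal (F y) \<partial>lebesgue)
    \<le> ennreal ((unit_ball_vol (real CARD('n)) + 1) * s ^ CARD('n) * s powr \<sigma> * G)"
proof -
  let ?V = "unit_ball_vol (real CARD('n))"
  let ?e = "real CARD('n) + \<sigma> * p"
  have e: "0 < ?e" using p \<sigma> by (intro add_pos_pos mult_pos_pos) auto
  have nm[measurable]: "(\<lambda>y. norm (x - y)) \<in> borel_measurable lebesgue"
    by (intro measurable_completion) simp
  have main: "(\<integral>\<^sup>+y\<in>ball x s. ennreal (F y) \<partial>lebesgue)
      \<le> ennreal (t * (?V * s ^ CARD('n)) + t powr (1 - p) * s powr ?e * G powr p)" if t: "0 < t" for t
  proof -
    have pt: "ennreal (F y) * indicator (ball x s) y \<le> ennreal t * indicator (ball x s) y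
        + ennreal (t powr (1 - p) * s powr ?e) * ennreal (F y powr p / norm (x - y) powr ?e)" for y
    proof (cases "y \<in> ball x s")
      case True
      have "F y \<le> t + t powr (1 - p) * s powr ?e * (F y powr p / norm (x - y) powr ?e)"
      proof (cases "F y \<le> t")
        case True
        then show ?thesis by (smt (verit) divide_nonneg_nonneg mult_nonneg_nonneg powr_ge_zero)
      next
        case False
        \<comment> \<open>\<open>F x = 0\<close> excludes \<open>y = x\<close>, where the quotient
          would be 0 by the convention on division.\<close>
        then have xy: "x \<noteq> y" and Fp: "0 < F y" using F0(2) t by auto
        have "1 \<le> (F y / t) powr (p - 1)" using False t p by (intro ge_one_powr_ge_zero) auto
        then have "F y \<le> F y * (F y / t) powr (p - 1)" using Fp by simp
        also have "\<dots> = t powr (1 - p) * F y powr p"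
        proof -
          have "F y * (F y / t) powr (p - 1) = F y * F y powr (p - 1) / t powr (p - 1)"
            using Fp t by (simp add: powr_divide)
          also have "\<dots> = F y powr p / t powr (p - 1)" using Fp by (simp add: powr_mult_base)
          also have "\<dots> = t powr (1 - p) * F y powr p"
            using powr_minus[of t "p - 1"] by (simp add: divide_inverse mult.commute)
          finally show ?thesis .
        qed
        also have "\<dots> \<le> t powr (1 - p) * (s powr ?e * (F y powr p / norm (x - y) powr ?e))"
        proof (intro mult_left_mono)
          have "norm (x - y) powr ?e \<le> s powr ?e"
            using True e by (intro powr_mono2) (auto simp: dist_norm)
          then have "F y powr p * norm (x - y) powr ?e \<le> F y powr p * s powr ?e" by (intro mult_left_mono) auto
          then show "F y powr p \<le> s powr ?e * (F y powr p / norm (x - y) powr ?e)"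
            using xy by (simp add: pos_le_divide_eq mult.commute)
        qed simp
        finally show ?thesis using t by (simp add: mult.assoc)
      qed
      then have "ennreal (F y) \<le> ennreal (t + t powr (1 - p) * s powr ?e * (F y powr p / norm (x - y) powr ?e))"
        by (rule ennreal_leI)
      also have "\<dots> = ennreal t + ennreal (t powr (1 - p) * s powr ?e) * ennreal (F y powr p / norm (x - y) powr ?e)"
        using t by (simp only: ennreal_plus ennreal_mult divide_nonneg_nonneg mult_nonneg_nonneg powr_ge_zero less_imp_le)
      finally show ?thesis using True by simp
    qed simp
    have "(\<integral>\<^sup>+y\<in>ball x s. ennreal (F y) \<partial>lebesgue) \<le>
      (\<integral>\<^sup>+y. ennreal t * indicator (ball x s) y
        + ennreal (t powr (1 - p) * s powr ?e) * ennreal (F y powr p / norm (x - y) powr ?e) \<partial>lebesgue)"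
      by (intro nn_integral_mono pt)
    also have "\<dots> = (\<integral>\<^sup>+y. ennreal t * indicator (ball x s) y \<partial>lebesgue) +
        (\<integral>\<^sup>+y. ennreal (t powr (1 - p) * s powr ?e) * ennreal (F y powr p / norm (x - y) powr ?e) \<partial>lebesgue)"
      by (rule nn_integral_add) (auto intro!: borel_measurable_times_ennreal borel_measurable_indicator)
    also have "(\<integral>\<^sup>+y. ennreal t * indicator (ball x s) y \<partial>lebesgue) = ennreal t * emeasure lebesgue (ball x s)"
      by (rule nn_integral_cmult_indicator) simp
    also have "(\<integral>\<^sup>+y. ennreal (t powr (1 - p) * s powr ?e) * ennreal (F y powr p / norm (x - y) powr ?e) \<partial>lebesgue)
      = ennreal (t powr (1 - p) * s powr ?e) * (\<integral>\<^sup>+y. ennreal (F y powr p / norm (x - y) powr ?e) \<partial>lebesgue)"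
      by (rule nn_integral_cmult) measurable
    also have "ennreal t * emeasure lebesgue (ball x s) + \<dots>
        \<le> ennreal t * ennreal (?V * s ^ CARD('n)) + ennreal (t powr (1 - p) * s powr ?e) * ennreal (G powr p)"
      using s by (intro add_mono mult_left_mono le) (auto simp: emeasure_lebesgue_ball simp del: emeasure_completion)
    also have "\<dots> = ennreal (t * (?V * s ^ CARD('n)) + t powr (1 - p) * s powr ?e * G powr p)"
      using t s by (simp add: ennreal_plus ennreal_mult)
    finally show ?thesis .
  qed
  show ?thesis
  proof (cases "G = 0")
    case False
    then have G: "0 < G" using G by simp
    define t where "t = s powr \<sigma> * G"
    have t: "0 < t" using s G by (simp add: t_def)
    have "t powr (1 - p) * s powr ?e * G powr p = s ^ CARD('n) * s powr \<sigma> * G"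
    proof -
      have "t powr (1 - p) = s powr (\<sigma> * (1 - p)) * G powr (1 - p)"
        using s G by (simp add: t_def powr_mult powr_powr)
      then have "t powr (1 - p) * s powr ?e * G powr p
        = (s powr (\<sigma> * (1 - p)) * s powr ?e) * (G powr (1 - p) * G powr p)" by simp
      also have "s powr (\<sigma> * (1 - p)) * s powr ?e = s powr (real CARD('n) + \<sigma>)"
        by (simp add: powr_add[symmetric] algebra_simps)
      also have "G powr (1 - p) * G powr p = G" using G by (simp add: powr_add[symmetric])
      finally show ?thesis using s by (simp add: powr_add powr_realpow)
    qed
    then have "t * (?V * s ^ CARD('n)) + t powr (1 - p) * s powr ?e * G powr p
        = (?V + 1) * s ^ CARD('n) * s powr \<sigma> * G"
      by (simp add: t_def algebra_simps)
    then show ?thesis using main[OF t] by simp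
  next
    case True
    \<comment> \<open>For \<open>G = 0\<close> the choice of \<open>t\<close> degenerates, but
      \<open>main\<close> then holds with its second summand zero and \<open>t\<close> arbitrarily
      small. \<open>Q\<close> is the volume of the ball.\<close>
    have "(\<integral>\<^sup>+y\<in>ball x s. ennreal (F y) \<partial>lebesgue) \<le> 0"
    proof (rule ennreal_le_epsilon)
      fix \<epsilon> :: real assume \<epsilon>: "0 < \<epsilon>"
      define Q where "Q = ?V * s ^ CARD('n)"
      have Q: "0 < Q" unfolding Q_def using s by simp
      show "(\<integral>\<^sup>+y\<in>ball x s. ennreal (F y) \<partial>lebesgue) \<le> 0 + ennreal \<epsilon>"
        using main[of "\<epsilon> / Q", folded Q_def] \<epsilon> Q True p by simp
    qed
    then show ?thesis by simp
  qed
qed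

text \<open>A kernel with \<open>m\<close> derivatives in slot \<open>i\<close> is
  \<open>s^m\<close> times the \<open>m\<close>-fold partial derivative of the kernel with
  \<open>b\<close> in that slot; this yields the factor \<open>s^m\<close>. Mean zero in a single
  slot gives the product mean zero, so the constant \<open>w x js\<close> can be subtracted, and the
  fractional integral yields \<open>s^\<sigma>\<close>.\<close>

lemma mollified_slot_le:
  fixes u :: "real ^ 'n \<Rightarrow> real" and i :: 'n
  assumes v: "has_weak_deriv l u v" and w: "has_weak_deriv (l + m) u w" and l: "length is = l"
    and g: "\<And>j. cbump d (g j)" and b: "cbump d b" "(LINT t|lborel. b t) = 0"
    and d: "d * real CARD('n) < 1" and s: "0 < s"
    and B: "\<And>j t. \<bar>g j t\<bar> \<le> B" "\<And>t. \<bar>b t\<bar> \<le> B" "0 \<le> B"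
    and p: "1 \<le> p" and \<sigma>: "0 < \<sigma>" and G: "0 \<le> G"
    and le: "(\<integral>\<^sup>+y. ennreal (tensor_norm (l + m) (\<lambda>is. w x is - w y is) powr p
      / norm (x - y) powr (real CARD('n) + \<sigma> * p)) \<partial>lebesgue) \<le> ennreal (G powr p)"
  shows "\<bar>LINT y|lebesgue. v y is * kern s x (g(i := (deriv ^^ m) b)) y\<bar>
    \<le> B ^ CARD('n) * (unit_ball_vol (real CARD('n)) + 1) * s powr (real m + \<sigma>) * G"
proof -
  let ?V = "unit_ball_vol (real CARD('n))"
  define js where "js = is @ replicate m i"
  have js: "length js = l + m" using l by (simp add: js_def)
  let ?g = "g(i := b)"
  let ?\<phi> = "kern s x ?g"
  let ?\<psi> = "iter_partial (replicate m i) ?\<phi>"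
  have g': "cbump d (?g j)" for j using g b by simp
  have sm: "smooth (?g j)" for j using g' by (simp add: cbump_def)
  have B': "\<bar>?g j t\<bar> \<le> B" for j t using B by simp
  have cl: "count_list (replicate m i) j = (if j = i then m else 0)" for j
    by (induction m) auto
  have "(\<lambda>j. (deriv ^^ count_list (replicate m i) j) (?g j)) = g(i := (deriv ^^ m) b)"
    by (auto simp: cl)
  then have \<psi>: "?\<psi> y = (1 / s) ^ m * kern s x (g(i := (deriv ^^ m) b)) y" for y
    using iter_partial_kern[where g = ?g, OF sm, of "replicate m i" s x y] by simp
  have wl: "locally_integrable (\<lambda>y. w y js)" using w js by (simp add: has_weak_deriv_def)
  have iw: "integrable lebesgue (\<lambda>y. w y js * ?\<phi> y)" by (rule kern_mult_integrable[OF wl g' s d])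
  have ik: "integrable lebesgue (\<lambda>y. w x js * ?\<phi> y)"
    using kern_integrable[where g = ?g and x = x, OF g' s] kern_borel[where g = ?g, OF sm, of s x] by (simp add: integrable_completion)
  have k0: "(LINT y|lebesgue. w x js * ?\<phi> y) = 0"
  proof -
    have "(LINT y|lborel. ?\<phi> y) = 0"
      using kern_integral[where g = ?g and x = x, OF g' s] b(2) by (auto intro!: prod_zero)
    then show ?thesis using kern_borel[where g = ?g, OF sm, of s x] by (simp add: integral_completion)
  qed
  have eq: "(\<lambda>y. w y js * ?\<phi> y - w x js * ?\<phi> y) = (\<lambda>y. (w y js - w x js) * ?\<phi> y)"
    by (simp add: left_diff_distrib)
  \<comment> \<open>That \<open>w\<close> is a weak derivative of \<open>v\<close> is not among the
    hypotheses; the passage goes through \<open>u\<close>, testing \<open>v\<close> with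
    \<open>?\<psi>\<close> and \<open>w\<close> with \<open>?\<phi>\<close>.\<close>
  have "\<bar>LINT y|lebesgue. v y is * ?\<psi> y\<bar> = \<bar>LINT y|lebesgue. u y * iter_partial is ?\<psi> y\<bar>"
    using v l test_function_iter_partial_kern[where g = ?g and x = x, OF g' s, of "replicate m i"]
    by (auto simp: has_weak_deriv_def abs_mult)
  also have "iter_partial is ?\<psi> = iter_partial js ?\<phi>" by (simp add: js_def iter_partial_append)
  also have "\<bar>LINT y|lebesgue. u y * iter_partial js ?\<phi> y\<bar> = \<bar>LINT y|lebesgue. w y js * ?\<phi> y\<bar>"
    using w js test_function_kern[where g = ?g and x = x, OF g' s]
    by (auto simp: has_weak_deriv_def abs_mult)
  also have "(LINT y|lebesgue. w y js * ?\<phi> y) = (LINT y|lebesgue. (w y js - w x js) * ?\<phi> y)"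
    using Bochner_Integration.integral_diff[OF iw ik] k0 eq by simp
  finally have E: "\<bar>LINT y|lebesgue. v y is * ?\<psi> y\<bar> = \<bar>LINT y|lebesgue. (w y js - w x js) * ?\<phi> y\<bar>" .
  have wm[measurable]: "(\<lambda>y. w y js) \<in> borel_measurable lebesgue" by (rule locally_integrable_measurable[OF wl])
  have "ennreal \<bar>LINT y|lebesgue. (w y js - w x js) * ?\<phi> y\<bar>
    \<le> ennreal ((B / s) ^ CARD('n)) * (\<integral>\<^sup>+y\<in>ball x s. ennreal \<bar>w y js - w x js\<bar> \<partial>lebesgue)"
  proof (rule abs_integral_mult_le)
    show "integrable lebesgue (\<lambda>y. (w y js - w x js) * ?\<phi> y)"
      using Bochner_Integration.integrable_diff[OF iw ik] eq by simp
    show "\<bar>?\<phi> y\<bar> \<le> (B / s) ^ CARD('n)" for y by (rule kern_bound[OF B' s])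
    show "y \<in> ball x s" if "?\<phi> y \<noteq> 0" for y by (rule kern_support[OF g' s d that])
  qed auto
  also have "\<dots> \<le> ennreal ((B / s) ^ CARD('n)) * ennreal ((?V + 1) * s ^ CARD('n) * s powr \<sigma> * G)"
  proof (intro mult_left_mono ball_integral_le_fractional[OF _ _ _ p s \<sigma> G])
    have "(\<integral>\<^sup>+y. ennreal (\<bar>w y js - w x js\<bar> powr p / norm (x - y) powr (real CARD('n) + \<sigma> * p)) \<partial>lebesgue)
      \<le> (\<integral>\<^sup>+y. ennreal (tensor_norm (l + m) (\<lambda>is. w x is - w y is) powr p
      / norm (x - y) powr (real CARD('n) + \<sigma> * p)) \<partial>lebesgue)"
    proof (intro nn_integral_mono ennreal_leI divide_right_mono powr_mono2)
      fix y
      show "\<bar>w y js - w x js\<bar> \<le> tensor_norm (l + m) (\<lambda>is. w x is - w y is)"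
        using abs_le_tensor_norm[OF js, of "\<lambda>is. w x is - w y is"] by (simp add: abs_minus_commute)
    qed (use p in auto)
    then show "(\<integral>\<^sup>+y. ennreal (\<bar>w y js - w x js\<bar> powr p / norm (x - y) powr (real CARD('n) + \<sigma> * p)) \<partial>lebesgue)
      \<le> ennreal (G powr p)" using le by (rule order_trans)
  qed auto
  also have "\<dots> = ennreal (B ^ CARD('n) * (?V + 1) * s powr \<sigma> * G)"
    using s B(3) G by (simp add: ennreal_mult[symmetric] power_divide)
  finally have "\<bar>LINT y|lebesgue. v y is * ?\<psi> y\<bar> \<le> B ^ CARD('n) * (?V + 1) * s powr \<sigma> * G"
    unfolding E using G B(3) by (subst (asm) ennreal_le_iff) auto
  moreover have "(LINT y|lebesgue. v y is * ?\<psi> y) = (1 / s) ^ m * (LINT y|lebesgue. v y is * kern s x (g(i := (deriv ^^ m) b)) y)"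
    unfolding \<psi> by (simp add: mult.left_commute[of _ "(1 / s) ^ m"])
  ultimately have "(1 / s) ^ m * \<bar>LINT y|lebesgue. v y is * kern s x (g(i := (deriv ^^ m) b)) y\<bar>
      \<le> B ^ CARD('n) * (?V + 1) * s powr \<sigma> * G"
    using s by (simp add: abs_mult power_abs)
  then have "s ^ m * ((1 / s) ^ m * \<bar>LINT y|lebesgue. v y is * kern s x (g(i := (deriv ^^ m) b)) y\<bar>)
      \<le> s ^ m * (B ^ CARD('n) * (?V + 1) * s powr \<sigma> * G)"
    by (rule mult_left_mono) (use s in simp)
  then show ?thesis using s by (simp add: powr_add powr_realpow power_one_over field_simps)
qed

text \<open>\<open>S\<close> is the set of coordinates already dilated. Enlarging it by one index
  changes one factor, and by \<open>hb\<close> the change is the derivative of order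
  \<open>m\<close> of \<open>b\<close>; after all coordinates the error has been paid
  \<open>N\<close> times.\<close>

lemma mollified_dyadic_step_le:
  fixes u :: "real ^ 'n \<Rightarrow> real"
  assumes v: "has_weak_deriv l u v" and w: "has_weak_deriv (l + m) u w" and l: "length is = l"
    and h: "cbump d h" and b: "cbump d b" "(LINT t|lborel. b t) = 0"
    and hb: "(\<lambda>t. 2 * h (2 * t) - h t) = (deriv ^^ m) b"
    and d: "d * real CARD('n) < 1" and s: "0 < s"
    and B: "\<And>t. \<bar>h t\<bar> \<le> B" "\<And>t. \<bar>2 * h (2 * t)\<bar> \<le> B" "\<And>t. \<bar>b t\<bar> \<le> B" "0 \<le> B"
    and p: "1 \<le> p" and \<sigma>: "0 < \<sigma>" and G: "0 \<le> G"
    and le: "(\<integral>\<^sup>+y. ennreal (tensor_norm (l + m) (\<lambda>is. w x is - w y is) powr p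
      / norm (x - y) powr (real CARD('n) + \<sigma> * p)) \<partial>lebesgue) \<le> ennreal (G powr p)"
  shows "\<bar>(LINT y|lebesgue. v y is * kern (s / 2) x (\<lambda>_. h) y) - (LINT y|lebesgue. v y is * kern s x (\<lambda>_. h) y)\<bar>
    \<le> real CARD('n) * (B ^ CARD('n) * (unit_ball_vol (real CARD('n)) + 1) * s powr (real m + \<sigma>) * G)"
proof -
  let ?K = "B ^ CARD('n) * (unit_ball_vol (real CARD('n)) + 1) * s powr (real m + \<sigma>) * G"
  let ?g = "\<lambda>S i. if i \<in> S then (\<lambda>t. 2 * h (2 * t)) else h"
  have vl: "locally_integrable (\<lambda>y. v y is)" using v l by (simp add: has_weak_deriv_def)
  have g: "cbump d (?g S i)" for S and i :: 'n using h cbump_dilate[OF h] by simp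
  have Bg: "\<bar>?g S i t\<bar> \<le> B" for S t and i :: 'n using B by simp
  have int: "integrable lebesgue (\<lambda>y. v y is * kern s x (?g S) y)" for S
    by (rule kern_mult_integrable[OF vl g s d])
  have "\<bar>(LINT y|lebesgue. v y is * kern s x (?g S) y) - (LINT y|lebesgue. v y is * kern s x (?g {}) y)\<bar>
      \<le> real (card S) * ?K" if "finite S" for S
    using that
  proof (induction S)
    case (insert i S)
    have e1: "?g (insert i S) = (?g S)(i := (\<lambda>t. 2 * h (2 * t)))" by (auto simp: fun_eq_iff)
    have e2: "?g S = (?g S)(i := h)" using insert.hyps by (auto simp: fun_eq_iff)
    have "kern s x (?g (insert i S)) y - kern s x (?g S) y = kern s x ((?g S)(i := (deriv ^^ m) b)) y" for y
      unfolding e1 by (subst (2) e2) (simp add: kern_diff_slot hb)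
    then have "(LINT y|lebesgue. v y is * kern s x (?g (insert i S)) y) - (LINT y|lebesgue. v y is * kern s x (?g S) y)
      = (LINT y|lebesgue. v y is * kern s x ((?g S)(i := (deriv ^^ m) b)) y)"
      by (subst Bochner_Integration.integral_diff[OF int int, symmetric]) (simp add: right_diff_distrib[symmetric])
    then have "\<bar>(LINT y|lebesgue. v y is * kern s x (?g (insert i S)) y) - (LINT y|lebesgue. v y is * kern s x (?g S) y)\<bar> \<le> ?K"
      using mollified_slot_le[where g = "?g S" and i = i and x = x, OF v w l g b d s Bg B(3,4) p \<sigma> G le] by simp
    then show ?case using insert.IH insert.hyps by (simp add: algebra_simps)
  qed simp
  from this[of UNIV] show ?thesis using kern_dilate[of s x "\<lambda>_. h"] by simp
qed

subsection \<open>The pointwise bound\<close>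

text \<open>Serves the measurability in \<open>x\<close> of the inner Gagliardo integral, which is
  taken over the completed measure.\<close>

lemma sigma_finite_lebesgue: "sigma_finite_measure (lebesgue :: 'a::euclidean_space measure)"
proof
  show "\<exists>A::'a set set. countable A \<and> A \<subseteq> sets lebesgue \<and> \<Union> A = space lebesgue \<and> (\<forall>a\<in>A. emeasure lebesgue a \<noteq> \<infinity>)"
  proof (intro exI conjI)
    let ?A = "range (\<lambda>n::nat. cball (0::'a) (real n))"
    show "countable ?A" by simp
    show "?A \<subseteq> sets lebesgue" by auto
    have "\<exists>n. x \<in> cball 0 (real n)" for x :: 'a
      using real_arch_simple[of "norm x"] by auto
    then show "\<Union> ?A = space lebesgue" by auto
    show "\<forall>a\<in>?A. emeasure lebesgue a \<noteq> \<infinity>"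
    proof
      fix a assume "a \<in> ?A"
      then obtain n :: nat where "a = cball 0 (real n)" by auto
      then show "emeasure lebesgue a \<noteq> \<infinity>"
        by (simp add: emeasure_cball)
    qed
  qed
qed

definition slice_seminorm ::
  "nat \<Rightarrow> real \<Rightarrow> real \<Rightarrow> (real ^ 'n \<Rightarrow> real) \<Rightarrow> real ^ 'n \<Rightarrow> ennreal" where
  "slice_seminorm k \<sigma> p u x =
     (\<integral>\<^sup>+y. ennreal
        (tensor_norm k (\<lambda>is. weak_deriv k u x is - weak_deriv k u y is) powr p
           / norm (x - y) powr (real CARD('n) + \<sigma> * p)) \<partial>lebesgue)"

lemma gagliardo_eq: "gagliardo k \<sigma> p u = (\<integral>\<^sup>+x. slice_seminorm k \<sigma> p u x \<partial>lebesgue)"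
  by (simp add: gagliardo_def slice_seminorm_def)

text \<open>Weak derivatives are merely Lebesgue measurable, so joint measurability is established
  in the product of the two completed sigma-algebras.\<close>

lemma slice_seminorm_measurable:
  fixes u :: "real ^ 'n \<Rightarrow> real"
  assumes "\<And>is. length is = k \<Longrightarrow> (\<lambda>x. weak_deriv k u x is) \<in> borel_measurable lebesgue"
  shows "slice_seminorm k \<sigma> p u \<in> borel_measurable lebesgue"
proof -
  let ?M = "lebesgue \<Otimes>\<^sub>M lebesgue :: ((real ^ 'n) \<times> (real ^ 'n)) measure"
  interpret L: sigma_finite_measure "lebesgue :: (real ^ 'n) measure" by (rule sigma_finite_lebesgue)
  have id: "(\<lambda>x. x) \<in> lebesgue \<rightarrow>\<^sub>M (borel :: (real ^ 'n) measure)" by (intro measurable_completion) simp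
  have [measurable]: "(\<lambda>z. fst z) \<in> ?M \<rightarrow>\<^sub>M borel" "(\<lambda>z. snd z) \<in> ?M \<rightarrow>\<^sub>M borel"
    using measurable_compose[OF measurable_fst id] measurable_compose[OF measurable_snd id] by auto
  have w[measurable]: "(\<lambda>z. weak_deriv k u (fst z) is) \<in> borel_measurable ?M"
    "(\<lambda>z. weak_deriv k u (snd z) is) \<in> borel_measurable ?M" if "length is = k" for "is"
    using measurable_compose[OF measurable_fst assms[OF that]] measurable_compose[OF measurable_snd assms[OF that]] by auto
  have t[measurable]: "(\<lambda>z. tensor_norm k (\<lambda>is. weak_deriv k u (fst z) is - weak_deriv k u (snd z) is)) \<in> borel_measurable ?M"
    unfolding tensor_norm_def
    by (intro borel_measurable_sqrt[THEN measurable_compose[rotated]] borel_measurable_sum borel_measurable_power borel_measurable_diff w) auto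
  have "(\<lambda>(x, y). ennreal (tensor_norm k (\<lambda>is. weak_deriv k u x is - weak_deriv k u y is) powr p
           / norm (x - y) powr (real CARD('n) + \<sigma> * p))) \<in> borel_measurable ?M"
    unfolding case_prod_beta by measurable
  then show ?thesis
    unfolding slice_seminorm_def[abs_def] by (rule L.borel_measurable_nn_integral)
qed

lemma sobolev_has_weak_deriv:
  assumes "u \<in> sobolev k p" "j \<le> k"
  shows "has_weak_deriv j u (weak_deriv j u)"
proof -
  have "\<exists>v. has_weak_deriv j u v" using assms by (auto simp: sobolev_def)
  then show ?thesis unfolding weak_deriv_def by (rule someI_ex)
qed

text \<open>The induction carries the closed form \<open>(b n - b j) / (1 - r)\<close> of the finite
  geometric sum; \<open>b j\<close> is discarded at the end.\<close>

lemma telescoping_bound: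
  fixes a b :: "nat \<Rightarrow> real"
  assumes step: "\<And>j. \<bar>a (Suc j) - a j\<bar> \<le> K * b j" and b: "\<And>j. b (Suc j) = r * b j" "\<And>j. 0 \<le> b j"
    and r: "r < 1" and K: "0 \<le> K" and j: "n \<le> j"
  shows "\<bar>a j\<bar> \<le> \<bar>a n\<bar> + K / (1 - r) * b n"
proof -
  have "\<bar>a j\<bar> \<le> \<bar>a n\<bar> + K / (1 - r) * (b n - b j)"
    using j
  proof (induction j rule: dec_induct)
    case (step j)
    have "K / (1 - r) * (b j - b (Suc j)) = K * b j"
      unfolding b(1) using r by (simp add: field_simps)
    moreover have "K / (1 - r) * (b n - b (Suc j)) = K / (1 - r) * (b n - b j) + K / (1 - r) * (b j - b (Suc j))"
      by (simp add: right_diff_distrib)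
    ultimately show ?case using step.IH assms(1)[of j] by linarith
  qed simp
  also have "K / (1 - r) * (b n - b j) \<le> K / (1 - r) * b n"
    using b(2)[of j] r K by (intro mult_left_mono) auto
  finally show ?thesis by simp
qed

lemma ex_kernel_bounded:
  assumes d: "0 < d" "d < 1"
  shows "\<exists>h b B. 0 < B \<and> cbump d h \<and> cbump d b \<and> (LINT t|lborel. h t) = 1 \<and> (LINT t|lborel. b t) = 0 \<and>
    (\<lambda>t. 2 * h (2 * t) - h t) = (deriv ^^ m) b \<and>
    (\<forall>a\<le>l. \<forall>t. \<bar>(deriv ^^ a) h t\<bar> \<le> B) \<and> (\<forall>t. \<bar>2 * h (2 * t)\<bar> \<le> B) \<and> (\<forall>t. \<bar>b t\<bar> \<le> B)"
proof -
  obtain h g where h: "cbump d h" "cbump d g" "(LINT t|lborel. h t) = 1"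
    and hg: "(\<lambda>t. 2 * h (2 * t) - h t) = (deriv ^^ Suc m) g"
    using ex_kernel[OF d, of m] by (elim exE conjE)
  \<comment> \<open>Of the \<open>m + 1\<close> derivatives one is kept inside \<open>b\<close> to
    give it mean zero, leaving \<open>m\<close> to be moved onto the weak derivative.\<close>
  define b where "b = deriv g"
  have b: "cbump d b" "(LINT t|lborel. b t) = 0"
    using cbump_deriv[OF h(2)] cbump_integral_deriv[OF h(2)] by (simp_all add: b_def)
  have hb: "(\<lambda>t. 2 * h (2 * t) - h t) = (deriv ^^ m) b"
    unfolding hg b_def by (simp add: funpow_swap1)
  have "\<forall>a. \<exists>B\<ge>0. \<forall>t. \<bar>(deriv ^^ a) h t\<bar> \<le> B"
    using cbump_bounded[OF cbump_higher_deriv[OF h(1)]] by blast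
  then obtain B0 where B0: "\<And>a. 0 \<le> B0 a" "\<And>a t. \<bar>(deriv ^^ a) h t\<bar> \<le> B0 a" by metis
  obtain B1 where B1: "0 \<le> B1" "\<And>t. \<bar>2 * h (2 * t)\<bar> \<le> B1" using cbump_bounded[OF cbump_dilate[OF h(1)]] by auto
  obtain B2 where B2: "0 \<le> B2" "\<And>t. \<bar>b t\<bar> \<le> B2" using cbump_bounded[OF b(1)] by auto
  define B where "B = (\<Sum>a\<le>l. B0 a) + B1 + B2 + 1"
  have S: "0 \<le> (\<Sum>a\<le>l. B0 a)" using B0 by (intro sum_nonneg) auto
  have "B0 a \<le> B" if "a \<le> l" for a
  proof -
    have "B0 a \<le> (\<Sum>a\<le>l. B0 a)" using B0 that by (intro member_le_sum) auto
    then show ?thesis using B1 B2 by (simp add: B_def)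
  qed
  then have "\<forall>a\<le>l. \<forall>t. \<bar>(deriv ^^ a) h t\<bar> \<le> B" using B0(2) order_trans by blast
  moreover have "0 < B" "\<forall>t. \<bar>2 * h (2 * t)\<bar> \<le> B" "\<forall>t. \<bar>b t\<bar> \<le> B"
    using S B1 B2 by (auto simp: B_def intro: order_trans[OF B1(2)] order_trans[OF B2(2)])
  ultimately show ?thesis using h(1,3) b hb by (intro exI conjI)
qed

text \<open>The order of quantifiers is the point: \<open>c\<close> precedes \<open>\<rho>\<close>
  and \<open>u\<close>, and a single null set serves all scales, so that the scale may later depend
  on \<open>x\<close>.\<close>

lemma pointwise_bound:
  fixes l m :: nat and p \<sigma> lam :: real
  assumes p: "1 \<le> p" and \<sigma>: "0 < \<sigma>"
  shows "\<exists>c>0. \<forall>\<rho>>0. \<forall>u :: real ^ 'n \<Rightarrow> real.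
    u \<in> frac_sobolev (l + m) \<sigma> p \<inter> campanato l \<rho> lam \<longrightarrow>
    (AE x in lebesgue. \<forall>n\<ge>1. tensor_norm l (weak_deriv l u x) \<le>
       c * ((\<rho> * (1 / 2) ^ n) powr (- (real l + lam)) * enn2real (campanato_seminorm l \<rho> lam u)
          + (\<rho> * (1 / 2) ^ n) powr (real m + \<sigma>) * enn2real (slice_seminorm (l + m) \<sigma> p u x) powr (1 / p)))"
proof -
  let ?N = "real CARD('n)"
  let ?V = "unit_ball_vol ?N"
  \<comment> \<open>Small enough for product kernels to fit into the Euclidean ball of radius
    \<open>s\<close>.\<close>
  define d where "d = 1 / (?N + 1)"
  have N: "?N > 0" by simp
  have d: "0 < d" "d < 1" "d * ?N < 1" using N by (auto simp: d_def divide_simps)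
  obtain h b B where B: "0 < B" and h: "cbump d h" "(LINT t|lborel. h t) = 1"
    and b: "cbump d b" "(LINT t|lborel. b t) = 0"
    and hb: "(\<lambda>t. 2 * h (2 * t) - h t) = (deriv ^^ m) b"
    and Bd: "\<forall>a\<le>l. \<forall>t. \<bar>(deriv ^^ a) h t\<bar> \<le> B" "\<forall>t. \<bar>2 * h (2 * t)\<bar> \<le> B" "\<forall>t. \<bar>b t\<bar> \<le> B"
    using ex_kernel_bounded[OF d(1,2), of m l] by (elim exE conjE)
  have Bh: "\<bar>h t\<bar> \<le> B" for t using Bd(1)[rule_format, of 0 t] by simp
  define \<beta> where "\<beta> = real m + \<sigma>"
  define r where "r = (1 / 2 :: real) powr \<beta>"
  have \<beta>: "0 < \<beta>" using \<sigma> by (simp add: \<beta>_def)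
  have r: "0 < r" "r < 1" using \<beta> powr_less_mono2[of \<beta> "1/2" 1] by (auto simp: r_def)
  define c1 where "c1 = B ^ CARD('n) * ?V"
  define K where "K = ?N * (B ^ CARD('n) * (?V + 1))"
  define c2 where "c2 = K / (1 - r)"
  have V: "0 \<le> ?V" by simp
  have K: "0 \<le> K" using B V by (auto simp: K_def intro!: mult_nonneg_nonneg)
  have c: "0 \<le> c1" "0 \<le> c2" using B V K r by (auto simp: c1_def c2_def)
  \<comment> \<open>One contribution from each component of the tensor; the 1 ensures
    positivity.\<close>
  define c where "c = real (card {is :: 'n list. length is = l}) * (c1 + c2) + 1"
  have "0 < c" using c by (auto simp: c_def intro!: add_nonneg_pos mult_nonneg_nonneg)
  moreover have "AE x in lebesgue. \<forall>n\<ge>1. tensor_norm l (weak_deriv l u x) \<le>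
       c * ((\<rho> * (1 / 2) ^ n) powr (- (real l + lam)) * enn2real (campanato_seminorm l \<rho> lam u)
          + (\<rho> * (1 / 2) ^ n) powr (real m + \<sigma>) * enn2real (slice_seminorm (l + m) \<sigma> p u x) powr (1 / p))"
    if \<rho>: "0 < \<rho>" and u: "u \<in> frac_sobolev (l + m) \<sigma> p \<inter> campanato l \<rho> lam" for \<rho> and u :: "real ^ 'n \<Rightarrow> real"
  proof -
    let ?A = "enn2real (campanato_seminorm l \<rho> lam u)"
    define S where "S = slice_seminorm (l + m) \<sigma> p u"
    define G where "G x = enn2real (S x) powr (1 / p)" for x
    define s where "s j = \<rho> * (1 / 2) ^ j" for j :: nat
    have s: "0 < s j" "s (Suc j) = s j / 2" for j using \<rho> by (auto simp: s_def)
    have s0: "s \<longlonglongrightarrow> 0"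
      unfolding s_def using tendsto_mult[OF tendsto_const LIMSEQ_power_zero[of "1/2::real"], of \<rho>] by simp
    have sob: "u \<in> sobolev (l + m) p" and fin: "gagliardo (l + m) \<sigma> p u < \<infinity>"
      and camp: "campanato_seminorm l \<rho> lam u < \<infinity>"
      using u by (auto simp: frac_sobolev_def campanato_def)
    have wk: "has_weak_deriv (l + m) u (weak_deriv (l + m) u)" and wl: "has_weak_deriv l u (weak_deriv l u)"
      by (rule sobolev_has_weak_deriv[OF sob], simp)+
    have Sm: "S \<in> borel_measurable lebesgue"
      unfolding S_def
      by (rule slice_seminorm_measurable) (use wk in \<open>auto simp: has_weak_deriv_def intro: locally_integrable_measurable\<close>)
    have Gm: "G \<in> borel_measurable lebesgue" unfolding G_def using Sm by measurable
    \<comment> \<open>\<open>enn2real\<close> sends infinity to 0, so points with an infinite inner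
      integral must be excluded; finiteness of the Gagliardo integral makes them a null set.\<close>
    have Sfin: "AE x in lebesgue. S x \<noteq> \<infinity>"
      by (rule nn_integral_noteq_infinite[OF Sm]) (use fin in \<open>simp add: gagliardo_eq S_def\<close>)
    have comp: "AE x in lebesgue. \<bar>weak_deriv l u x is\<bar> \<le>
        c1 * s n powr (- (real l + lam)) * ?A + c2 * s n powr \<beta> * G x"
      if il: "length is = l" and n: "n \<ge> 1" for "is" and n
    proof (rule AE_le_of_mollified[where d = d and h = "\<lambda>_. h" and s = s and n = n])
      show "locally_integrable (\<lambda>x. weak_deriv l u x is)" using wl il by (simp add: has_weak_deriv_def)
      show "cbump d h" by (rule h)
      show "(\<Prod>i\<in>(UNIV :: 'n set). LINT t|lborel. h t) = 1" by (simp add: h)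
      show "d * ?N < 1" by (rule d)
      show "(\<lambda>x. c1 * s n powr (- (real l + lam)) * ?A + c2 * s n powr \<beta> * G x) \<in> borel_measurable lebesgue"
        using Gm by measurable
      show "AE x in lebesgue. \<forall>j\<ge>n. \<bar>LINT y|lebesgue. weak_deriv l u y is * kern (s j) x (\<lambda>_. h) y\<bar>
          \<le> c1 * s n powr (- (real l + lam)) * ?A + c2 * s n powr \<beta> * G x"
        using Sfin
      proof eventually_elim
        case (elim x)
        let ?a = "\<lambda>j. LINT y|lebesgue. weak_deriv l u y is * kern (s j) x (\<lambda>_. h) y"
        have G0: "0 \<le> G x" by (simp add: G_def)
        have "G x powr p = enn2real (S x)" using p by (simp add: G_def powr_powr)
        then have "S x = ennreal (G x powr p)" using elim by (simp add: ennreal_enn2real_if)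
        then have le: "(\<integral>\<^sup>+y. ennreal (tensor_norm (l + m) (\<lambda>is. weak_deriv (l + m) u x is - weak_deriv (l + m) u y is) powr p
            / norm (x - y) powr (?N + \<sigma> * p)) \<partial>lebesgue) \<le> ennreal (G x powr p)"
          unfolding S_def slice_seminorm_def by simp
        have step: "\<bar>?a (Suc j) - ?a j\<bar> \<le> (K * G x) * s j powr \<beta>" for j
          using mollified_dyadic_step_le[OF wl wk il h(1) b hb d(3) s(1) Bh Bd(2,3)[rule_format] less_imp_le[OF B] p \<sigma> G0 le, of j]
          by (simp add: s(2) K_def \<beta>_def mult_ac)
        have sr: "s (Suc j) powr \<beta> = r * s j powr \<beta>" for j
          using s(1)[of j] by (simp add: s(2) r_def powr_divide)
        have an: "\<bar>?a n\<bar> \<le> c1 * s n powr (- (real l + lam)) * ?A"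
          unfolding c1_def
        proof (rule mollified_weak_deriv_le_campanato[OF wl il _ d(3) s(1) _ _ B camp])
          show "cbump d h" by (rule h)
          \<comment> \<open>The semi-norm admits radii strictly below \<open>\<rho>\<close>, hence
            \<open>n \<ge> 1\<close>.\<close>
          have "(1 / 2 :: real) ^ n < 1" using n by (simp add: power_less_one_iff)
          then show "s n < \<rho>" using \<rho> by (simp add: s_def)
          show "\<bar>(deriv ^^ count_list is i) h t\<bar> \<le> B" for i t
            using Bd(1) count_le_length[of "is" i] il by simp
        qed
        show ?case
        proof (intro allI impI)
          fix j assume "n \<le> j"
          then have "\<bar>?a j\<bar> \<le> \<bar>?a n\<bar> + K * G x / (1 - r) * s n powr \<beta>"
            using telescoping_bound[of ?a "K * G x" "\<lambda>j. s j powr \<beta>" r n j, OF step sr _ r(2)] K G0 by simp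
          then show "\<bar>?a j\<bar> \<le> c1 * s n powr (- (real l + lam)) * ?A + c2 * s n powr \<beta> * G x"
            using an by (simp add: c2_def mult_ac)
        qed
      qed
    qed (use s s0 in auto)
    \<comment> \<open>The exceptional sets depend on the scale and on the component, hence are
      countably many.\<close>
    have "AE x in lebesgue. \<forall>n\<in>{1..}. \<forall>is\<in>{is. length is = l}. \<bar>weak_deriv l u x is\<bar> \<le>
        c1 * s n powr (- (real l + lam)) * ?A + c2 * s n powr \<beta> * G x"
      using comp by (subst AE_ball_countable, simp, intro ballI, subst AE_finite_all[OF finite_lists_of_length]) auto
    then show ?thesis
    proof eventually_elim
      case (elim x)
      show ?case
      proof (intro allI impI)
        fix n :: nat assume n: "1 \<le> n"
        let ?X = "s n powr (- (real l + lam)) * ?A" and ?Y = "s n powr \<beta> * G x"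
        have XY: "0 \<le> ?X" "0 \<le> ?Y" by (auto simp: G_def)
        have "tensor_norm l (weak_deriv l u x) \<le> (\<Sum>is | length is = l. \<bar>weak_deriv l u x is\<bar>)"
          by (rule tensor_norm_le_sum)
        also have "\<dots> \<le> (\<Sum>is :: 'n list | length is = l. (c1 + c2) * (?X + ?Y))"
        proof (rule sum_mono)
          fix "is" :: "'n list" assume "is \<in> {is. length is = l}"
          then have "\<bar>weak_deriv l u x is\<bar> \<le> c1 * ?X + c2 * ?Y" using elim n by (auto simp: mult.assoc)
          also have "\<dots> \<le> (c1 + c2) * (?X + ?Y)" using c XY by (simp add: algebra_simps)
          finally show "\<bar>weak_deriv l u x is\<bar> \<le> (c1 + c2) * (?X + ?Y)" .
        qed
        also have "\<dots> = (c - 1) * (?X + ?Y)" by (simp add: c_def)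
        also have "\<dots> \<le> c * (?X + ?Y)" using XY by (intro mult_right_mono) auto
        finally show "tensor_norm l (weak_deriv l u x) \<le>
           c * ((\<rho> * (1 / 2) ^ n) powr (- (real l + lam)) * ?A
          + (\<rho> * (1 / 2) ^ n) powr (real m + \<sigma>) * enn2real (slice_seminorm (l + m) \<sigma> p u x) powr (1 / p))"
          by (simp add: s_def \<beta>_def G_def S_def)
      qed
    qed
  qed
  ultimately show ?thesis by blast
qed

section \<open>Choice of the scale\<close>

lemma ex_dyadic_scale:
  assumes "0 < t" "t \<le> (1 / 2 :: real)"
  shows "\<exists>n\<ge>1. (1 / 2) ^ n \<le> t \<and> t / 2 \<le> (1 / 2) ^ n"
proof -
  let ?P = "\<lambda>n. (1 / 2 :: real) ^ n \<le> t"
  obtain k where "(1 / 2) ^ k < t" using real_arch_pow_inv[OF assms(1), of "1/2"] by auto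
  then have ex: "\<exists>n. ?P n" by (intro exI[of _ k]) simp
  \<comment> \<open>Minimality gives \<open>t < (1/2)^(n-1)\<close>, hence the lower bound
    \<open>t / 2\<close>; \<open>t \<le> 1/2\<close> rules out \<open>n = 0\<close>.\<close>
  define n where "n = (LEAST n. ?P n)"
  have n: "?P n" unfolding n_def using ex by (rule LeastI_ex)
  then have "n \<noteq> 0" using assms by (cases n) auto
  then obtain k where k: "n = Suc k" by (cases n) auto
  then have "\<not> ?P k" unfolding n_def using not_less_Least[of k ?P] by simp
  then show ?thesis using n k by (intro exI[of _ n]) auto
qed

text \<open>
  If \<open>V \<le> M * A\<close>, the term \<open>V powr p\<close> suffices. Otherwise the scale
  \<open>t = (M * A / V) powr ((q - p) / (p * \<beta>)) / 2\<close> makes the first summand at most \<open>V / 2\<close>.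
\<close>

lemma optimize_scale:
  fixes c \<alpha> \<beta> p q V A G :: real
  assumes c: "0 < c" and \<alpha>: "0 \<le> \<alpha>" and \<beta>: "0 < \<beta>" and p: "1 \<le> p" "p < q"
    and cond: "(q - p) * \<alpha> \<le> p * \<beta>"
    and nn: "0 \<le> V" "0 \<le> A" "0 \<le> G"
    and bound: "\<And>n::nat. n \<ge> 1 \<Longrightarrow> V \<le> c * (((1 / 2) ^ n) powr (- \<alpha>) * A + ((1 / 2) ^ n) powr \<beta> * G)"
  defines "M \<equiv> 2 * c * 4 powr \<alpha>"
  shows "V powr q \<le> ((2 * c) powr p * M powr (q - p) + M powr (q - p)) * A powr (q - p) * (G powr p + V powr p)"
proof -
  let ?C = "(2 * c) powr p * M powr (q - p) + M powr (q - p)"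
  have M: "0 < M" using c by (simp add: M_def)
  have Vq: "V powr q = V powr p * V powr (q - p)" by (simp add: powr_add[symmetric])
  show ?thesis
  proof (cases "V \<le> M * A")
    case True
    have "V powr q \<le> V powr p * (M powr (q - p) * A powr (q - p))"
      unfolding Vq using True nn M p
      by (intro mult_left_mono) (auto simp: powr_mult[symmetric] intro!: powr_mono2)
    also have "\<dots> \<le> V powr p * (?C * A powr (q - p))"
      by (intro mult_left_mono mult_right_mono) auto
    also have "\<dots> \<le> (G powr p + V powr p) * (?C * A powr (q - p))"
      by (intro mult_right_mono mult_nonneg_nonneg) auto
    finally show ?thesis by (simp add: mult_ac)
  next
    case False
    then have V: "0 < V" using nn M by (smt (verit) mult_nonneg_nonneg)
    show ?thesis
    proof (cases "A = 0")
      case True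
      \<comment> \<open>Without \<open>A\<close> no scale is optimal; letting the scale tend to zero
        contradicts \<open>V > 0\<close>.\<close>
      have "((1 / 2 :: real) ^ n) powr \<beta> = ((1 / 2) powr \<beta>) ^ n" for n
        by (simp add: powr_realpow[symmetric] powr_powr mult.commute)
      moreover have "(\<lambda>n. ((1 / 2 :: real) powr \<beta>) ^ n) \<longlonglongrightarrow> 0"
        using \<beta> powr_less_mono2[of \<beta> "1/2" 1] by (intro LIMSEQ_power_zero) auto
      ultimately have "(\<lambda>n. ((1 / 2 :: real) ^ n) powr \<beta>) \<longlonglongrightarrow> 0" by simp
      then have "(\<lambda>n. c * (((1 / 2 :: real) ^ n) powr \<beta> * G)) \<longlonglongrightarrow> c * (0 * G)"
        by (intro tendsto_intros)
      moreover have "\<exists>N. \<forall>n\<ge>N. V \<le> c * (((1 / 2 :: real) ^ n) powr \<beta> * G)"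
        using bound True by (intro exI[of _ 1]) auto
      ultimately have "V \<le> c * (0 * G)" by (rule LIMSEQ_le_const)
      then show ?thesis using V by simp
    next
      case A0: False
      then have A: "0 < A" using nn by simp
      \<comment> \<open>The exponent solves \<open>e * p * \<beta> = q - p\<close>, which produces
        the power \<open>q - p\<close> in the Gagliardo term; \<open>e * \<alpha> \<le> 1\<close> is
        then exactly \<open>cond\<close>.\<close>
      define e where "e = (q - p) / (p * \<beta>)"
      define W where "W = V / (M * A)"
      have W: "1 \<le> W" using False M A by (simp add: W_def)
      have e: "0 \<le> e" "e * \<alpha> \<le> 1" using p \<beta> cond by (auto simp: e_def pos_divide_le_eq)
      define t where "t = W powr (- e) / 2"
      have "W powr (- e) \<le> 1" using W e powr_mono[of "- e" 0 W] by simp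
      then have t: "0 < t" "t \<le> 1 / 2" using W by (auto simp: t_def)
      obtain n where n: "n \<ge> 1" "(1 / 2) ^ n \<le> t" "t / 2 \<le> (1 / 2) ^ n"
        using ex_dyadic_scale[OF t] by blast
      have "((1 / 2 :: real) ^ n) powr (- \<alpha>) \<le> (t / 2) powr (- \<alpha>)"
        using n(3) t \<alpha> by (intro powr_mono2') auto
      \<comment> \<open>Origin of the 4 in \<open>M\<close>: one factor 2 from the definition of
        \<open>t\<close>, another from rounding to a dyadic scale.\<close>
      also have "(t / 2) powr (- \<alpha>) = 4 powr \<alpha> * W powr (e * \<alpha>)"
        using W by (simp add: t_def powr_divide powr_powr powr_minus_divide powr_mult)
      also have "\<dots> \<le> 4 powr \<alpha> * W"
        using W e powr_mono[of "e * \<alpha>" 1 W] by (intro mult_left_mono) auto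
      finally have "((1 / 2 :: real) ^ n) powr (- \<alpha>) * A \<le> 4 powr \<alpha> * W * A"
        by (rule mult_right_mono) (use A in simp)
      also have "\<dots> = V / (2 * c)" using A c by (simp add: W_def M_def)
      finally have "c * (((1 / 2 :: real) ^ n) powr (- \<alpha>) * A) \<le> c * (V / (2 * c))"
        by (rule mult_left_mono) (use c in simp)
      then have "c * (((1 / 2 :: real) ^ n) powr (- \<alpha>) * A) \<le> V / 2" using c by simp
      moreover have "c * (((1 / 2 :: real) ^ n) powr \<beta> * G) \<le> c * (t powr \<beta> * G)"
        using n(2) \<beta> nn c by (intro mult_left_mono mult_right_mono powr_mono2) auto
      ultimately have "V \<le> 2 * c * (t powr \<beta> * G)"
        using bound[OF n(1)] by (simp add: distrib_left)
      then have "V powr p \<le> (2 * c * (t powr \<beta> * G)) powr p" using nn p by (intro powr_mono2) auto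
      also have "\<dots> = (2 * c) powr p * (t powr (\<beta> * p) * G powr p)"
        using c nn by (simp add: powr_mult powr_powr)
      also have "\<dots> \<le> (2 * c) powr p * ((M * A / V) powr (q - p) * G powr p)"
      proof (intro mult_left_mono mult_right_mono)
        have "t powr (\<beta> * p) \<le> (W powr (- e)) powr (\<beta> * p)"
          unfolding t_def using \<beta> p by (intro powr_mono2) auto
        also have "\<dots> = W powr (- (q - p))" using p \<beta> by (simp add: powr_powr e_def)
        also have "\<dots> = (1 / W) powr (q - p)" using W by (simp only: powr_minus_divide powr_divide powr_one_eq_one)
        also have "1 / W = M * A / V" by (simp add: W_def)
        finally show "t powr (\<beta> * p) \<le> (M * A / V) powr (q - p)" .
      qed auto
      finally have "V powr q \<le> (2 * c) powr p * ((M * A / V) powr (q - p) * G powr p) * V powr (q - p)"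
        unfolding Vq by (rule mult_right_mono) simp
      also have "\<dots> = (2 * c) powr p * M powr (q - p) * A powr (q - p) * G powr p"
        using V M A by (simp add: powr_divide powr_mult)
      also have "\<dots> \<le> ?C * A powr (q - p) * (G powr p + V powr p)"
        by (intro mult_mono mult_nonneg_nonneg) auto
      finally show ?thesis .
    qed
  qed
qed

theorem theorem4p1:
  fixes k l :: nat and p q \<sigma> lam :: real
  assumes "k \<ge> 1" and "l \<in> {0..k - 1}"
    and "1 \<le> p" and "p < q" and "0 < \<sigma>" and "\<sigma> < 1"
    and "- real l \<le> lam" and "lam \<le> ((real k + \<sigma>) * p - real l * q) / (q - p)"
  shows "\<exists>C\<ge>0. \<forall>\<rho>>0. \<forall>u :: real ^ 'n \<Rightarrow> real.
    u \<in> frac_sobolev k \<sigma> p \<inter> campanato l \<rho> lam \<longrightarrow>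
      weak_deriv l u \<in> tensor_Lp l q \<and>
      (\<integral>\<^sup>+x. ennreal (\<rho> powr (real l * q) * tensor_norm l (weak_deriv l u x) powr q) \<partial>lebesgue)
        \<le> ennreal (C * (\<rho> powr (- lam) * enn2real (campanato_seminorm l \<rho> lam u)) powr (q - p)) *
          (ennreal (\<rho> powr (p * (real k + \<sigma>))) * gagliardo k \<sigma> p u
           + (\<integral>\<^sup>+x. ennreal (\<rho> powr (real l * p) * tensor_norm l (weak_deriv l u x) powr p)
               \<partial>lebesgue))"
proof -
  define m where "m = k - l"
  have k: "k = l + m" and m: "1 \<le> m" using assms(1,2) by (auto simp: m_def)
  have p: "0 < p" using assms by simp
  define \<alpha> where "\<alpha> = real l + lam"
  define \<beta> where "\<beta> = real m + \<sigma>"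
  have \<alpha>: "0 \<le> \<alpha>" and \<beta>: "0 < \<beta>" using assms by (auto simp: \<alpha>_def \<beta>_def)
  have "lam * (q - p) \<le> (real k + \<sigma>) * p - real l * q"
    using assms(8) \<open>p < q\<close> by (simp add: pos_le_divide_eq)
  \<comment> \<open>Adding \<open>(q - p) * l\<close> to both sides turns the right-hand side into
    \<open>p * (k - l + \<sigma>)\<close>.\<close>
  then have cond: "(q - p) * \<alpha> \<le> p * \<beta>"
    by (simp add: \<alpha>_def \<beta>_def k algebra_simps)
  obtain c where c: "0 < c" and pw: "\<And>\<rho> (u :: real ^ 'n \<Rightarrow> real). 0 < \<rho> \<Longrightarrow> u \<in> frac_sobolev k \<sigma> p \<inter> campanato l \<rho> lam \<Longrightarrow>
    (AE x in lebesgue. \<forall>n\<ge>1. tensor_norm l (weak_deriv l u x) \<le>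
       c * ((\<rho> * (1 / 2) ^ n) powr (- \<alpha>) * enn2real (campanato_seminorm l \<rho> lam u)
          + (\<rho> * (1 / 2) ^ n) powr \<beta> * enn2real (slice_seminorm k \<sigma> p u x) powr (1 / p)))"
    using pointwise_bound[OF assms(3,5), where l = l and m = m and lam = lam and ?'n = 'n]
    unfolding k \<alpha>_def \<beta>_def by blast
  define M where "M = 2 * c * 4 powr \<alpha>"
  define C where "C = (2 * c) powr p * M powr (q - p) + M powr (q - p)"
  have C: "0 \<le> C" by (simp add: C_def)
  have "weak_deriv l u \<in> tensor_Lp l q \<and>
      (\<integral>\<^sup>+x. ennreal (\<rho> powr (real l * q) * tensor_norm l (weak_deriv l u x) powr q) \<partial>lebesgue)
        \<le> ennreal (C * (\<rho> powr (- lam) * enn2real (campanato_seminorm l \<rho> lam u)) powr (q - p)) *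
          (ennreal (\<rho> powr (p * (real k + \<sigma>))) * gagliardo k \<sigma> p u
           + (\<integral>\<^sup>+x. ennreal (\<rho> powr (real l * p) * tensor_norm l (weak_deriv l u x) powr p)
               \<partial>lebesgue))"
    if \<rho>: "0 < \<rho>" and u: "u \<in> frac_sobolev k \<sigma> p \<inter> campanato l \<rho> lam" for \<rho> and u :: "real ^ 'n \<Rightarrow> real"
  proof -
    define A where "A = \<rho> powr (- lam) * enn2real (campanato_seminorm l \<rho> lam u)"
    define S where "S = slice_seminorm k \<sigma> p u"
    define V where "V x = tensor_norm l (weak_deriv l u x)" for x
    have A0: "0 \<le> A" by (simp add: A_def)
    have V0: "0 \<le> V x" for x by (simp add: V_def tensor_norm_nonneg)
    have sob: "u \<in> sobolev k p" and fin: "gagliardo k \<sigma> p u < \<infinity>" using u by (auto simp: frac_sobolev_def)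
    have Lp: "weak_deriv l u \<in> tensor_Lp l p" using sob k by (simp add: sobolev_def)
    have Sm[measurable]: "S \<in> borel_measurable lebesgue"
      unfolding S_def
      by (rule slice_seminorm_measurable)
        (use sobolev_has_weak_deriv[OF sob order_refl] in \<open>auto simp: has_weak_deriv_def intro: locally_integrable_measurable\<close>)
    have Vm[measurable]: "V \<in> borel_measurable lebesgue"
      unfolding V_def tensor_norm_def
      using Lp by (intro borel_measurable_sqrt[THEN measurable_compose[rotated]] borel_measurable_sum borel_measurable_power)
        (auto simp: tensor_Lp_def)
    have Sfin: "AE x in lebesgue. S x \<noteq> \<infinity>"
      by (rule nn_integral_noteq_infinite[OF Sm]) (use fin in \<open>simp add: gagliardo_eq S_def\<close>)
    have main: "AE x in lebesgue. ennreal (\<rho> powr (real l * q) * V x powr q)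
      \<le> ennreal (C * A powr (q - p)) * (ennreal (\<rho> powr (p * (real k + \<sigma>))) * S x + ennreal (\<rho> powr (real l * p) * V x powr p))"
      using pw[OF \<rho> u] Sfin
    proof eventually_elim
      case (elim x)
      \<comment> \<open>The powers of \<open>\<rho>\<close> in \<open>A\<close>, \<open>G\<close>
        and \<open>W\<close> reduce the pointwise bound to the case \<open>\<rho> = 1\<close>, as
        \<open>e1\<close> and \<open>e2\<close> confirm.\<close>
      define G where "G = \<rho> powr (real k + \<sigma>) * enn2real (S x) powr (1 / p)"
      define W where "W = \<rho> powr real l * V x"
      have "W \<le> c * (((1 / 2) ^ n) powr (- \<alpha>) * A + ((1 / 2) ^ n) powr \<beta> * G)" if n: "n \<ge> 1" for n :: nat
      proof -
        let ?\<tau> = "(1 / 2 :: real) ^ n"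
        have e1: "\<rho> powr real l * (\<rho> * ?\<tau>) powr (- \<alpha>) = ?\<tau> powr (- \<alpha>) * \<rho> powr (- lam)"
          using \<rho> by (simp add: powr_mult \<alpha>_def powr_add[symmetric] mult.left_commute)
        have e2: "\<rho> powr real l * (\<rho> * ?\<tau>) powr \<beta> = ?\<tau> powr \<beta> * \<rho> powr (real k + \<sigma>)"
          using \<rho> by (simp add: powr_mult \<beta>_def k powr_add[symmetric] mult.left_commute add.assoc)
        have "W \<le> \<rho> powr real l * (c * ((\<rho> * ?\<tau>) powr (- \<alpha>) * enn2real (campanato_seminorm l \<rho> lam u)
            + (\<rho> * ?\<tau>) powr \<beta> * enn2real (S x) powr (1 / p)))"
          unfolding W_def V_def S_def using elim n by (intro mult_left_mono) auto
        also have "\<dots> = c * ((\<rho> powr real l * (\<rho> * ?\<tau>) powr (- \<alpha>)) * enn2real (campanato_seminorm l \<rho> lam u)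
            + (\<rho> powr real l * (\<rho> * ?\<tau>) powr \<beta>) * enn2real (S x) powr (1 / p))"
          by (simp add: algebra_simps)
        finally show ?thesis unfolding e1 e2 by (simp add: A_def G_def mult.assoc)
      qed
      then have "W powr q \<le> C * A powr (q - p) * (G powr p + W powr p)"
        unfolding C_def M_def
        by (intro optimize_scale[OF c \<alpha> \<beta> assms(3,4) cond]) (auto simp: A0 W_def V0 G_def)
      also have "G powr p = \<rho> powr (p * (real k + \<sigma>)) * enn2real (S x)"
        using \<rho> p by (simp add: G_def powr_mult powr_powr mult.commute)
      finally have "ennreal (W powr q) \<le> ennreal (C * A powr (q - p) * (\<rho> powr (p * (real k + \<sigma>)) * enn2real (S x) + W powr p))"
        by (rule ennreal_leI)
      also have "\<dots> = ennreal (C * A powr (q - p)) * (ennreal (\<rho> powr (p * (real k + \<sigma>))) * ennreal (enn2real (S x)) + ennreal (W powr p))"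
        using C by (simp add: ennreal_mult ennreal_plus)
      also have "ennreal (enn2real (S x)) = S x" using elim(2) by (simp add: ennreal_enn2real_if)
      finally show ?case using \<rho> V0[of x] by (simp add: W_def powr_mult powr_powr)
    qed
    have "(\<integral>\<^sup>+x. ennreal (\<rho> powr (real l * q) * V x powr q) \<partial>lebesgue)
      \<le> (\<integral>\<^sup>+x. ennreal (C * A powr (q - p)) * (ennreal (\<rho> powr (p * (real k + \<sigma>))) * S x + ennreal (\<rho> powr (real l * p) * V x powr p)) \<partial>lebesgue)"
      by (rule nn_integral_mono_AE[OF main])
    also have "\<dots> = ennreal (C * A powr (q - p)) * (\<integral>\<^sup>+x. ennreal (\<rho> powr (p * (real k + \<sigma>))) * S x + ennreal (\<rho> powr (real l * p) * V x powr p) \<partial>lebesgue)"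
      by (rule nn_integral_cmult) measurable
    also have "(\<integral>\<^sup>+x. ennreal (\<rho> powr (p * (real k + \<sigma>))) * S x + ennreal (\<rho> powr (real l * p) * V x powr p) \<partial>lebesgue)
      = (\<integral>\<^sup>+x. ennreal (\<rho> powr (p * (real k + \<sigma>))) * S x \<partial>lebesgue) + (\<integral>\<^sup>+x. ennreal (\<rho> powr (real l * p) * V x powr p) \<partial>lebesgue)"
      by (rule nn_integral_add) measurable
    also have "(\<integral>\<^sup>+x. ennreal (\<rho> powr (p * (real k + \<sigma>))) * S x \<partial>lebesgue) = ennreal (\<rho> powr (p * (real k + \<sigma>))) * gagliardo k \<sigma> p u"
      unfolding gagliardo_eq S_def[symmetric] by (rule nn_integral_cmult) measurable
    finally have ineq: "(\<integral>\<^sup>+x. ennreal (\<rho> powr (real l * q) * V x powr q) \<partial>lebesgue)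
      \<le> ennreal (C * A powr (q - p)) * (ennreal (\<rho> powr (p * (real k + \<sigma>))) * gagliardo k \<sigma> p u
        + (\<integral>\<^sup>+x. ennreal (\<rho> powr (real l * p) * V x powr p) \<partial>lebesgue))" .
    have "integrable lebesgue (\<lambda>x. \<rho> powr (real l * p) * V x powr p)"
      using Lp by (simp add: tensor_Lp_def V_def)
    then have "(\<integral>\<^sup>+x. ennreal (\<rho> powr (real l * p) * V x powr p) \<partial>lebesgue) < \<infinity>"
      by (simp add: nn_integral_eq_integral)
    \<comment> \<open>Membership in \<open>L^q\<close> comes out of the inequality itself, whose
      right-hand side is finite.\<close>
    then have "(\<integral>\<^sup>+x. ennreal (\<rho> powr (real l * q) * V x powr q) \<partial>lebesgue) < \<infinity>"
      using ineq fin by (auto simp: ennreal_mult_less_top intro!: order.strict_trans1[OF ineq])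
    then have "integrable lebesgue (\<lambda>x. \<rho> powr (real l * q) * V x powr q)"
      by (intro integrableI_nonneg) auto
    then have "integrable lebesgue (\<lambda>x. V x powr q)" using \<rho> by simp
    then have "weak_deriv l u \<in> tensor_Lp l q" using Lp by (simp add: tensor_Lp_def V_def)
    then show ?thesis using ineq by (simp add: A_def V_def)
  qed
  then show ?thesis using C by blast
qed

end
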